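(* Let $p$ be a prime number. Let $A$ and $B$ be groups, $H\leqslant A$ and $K\leqslant B$ subgroups, $\varphi: H\to K$ an isomorphism, and let $G=(A*B;\,H=K,\varphi)$ be the free product of $A$ and $B$ with $H$ and $K$ amalgamated according to $\varphi$. Let $\Omega^p$ be the family of all ordered pairs $(A\cap N,\,B\cap N)$, where $N$ ranges over the normal subgroups of $G$ of finite $p$-index. Suppose that $A$ and $B$ are residually $p$-finite, that $H$ is $p$-separable in $A$ and $K$ is $p$-separable in $B$, and that for any normal subgroups of finite $p$-index $M\leqslant A$ and $N\leqslant B$ there exists a pair $(R,S)\in\Omega^p$ such that $R\leqslant M$ and $S\leqslant N$. Then every $p'$-isolated cyclic subgroup of $G$ that is not conjugate in $G$ to any subgroup of the family $\Delta_A^p\cup\Delta_B^p$ is $p$-separable in $G$.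
   Context: A subgroup of finite $p$-index is a subgroup whose index is a (finite) power of $p$, $p^0=1$ allowed. A subgroup $F$ of a group $X$ is $p$-separable in $X$ if for every $g\in X\setminus F$ there is a homomorphism $\psi$ of $X$ onto a finite $p$-group with $g\psi\notin F\psi$. $X$ is residually $p$-finite if its trivial subgroup is $p$-separable. A subgroup $Y$ of a group $X$ is $p'$-isolated (in $X$) if for every $g\in X$ and every prime $q\neq p$, $g^q\in Y$ implies $g\in Y$. $\Delta_A^p$ (resp. $\Delta_B^p$) is the family of all cyclic subgroups of $A$ (resp. $B$) that are $p'$-isolated in $A$ (resp. $B$) but not $p$-separable in $A$ (resp. $B$). *)

theory Defs
  imports "HOL-Algebra.Algebra"
begin

section \<open>Free products with amalgamated subgroups\<close>

text \<open>
  The free product of \<open>A\<close> and \<open>B\<close> with \<open>H\<close> and \<open>K = \<phi> ` H\<close> amalgamated is given by the presentation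
  whose generators are the elements of \<open>A\<close> and of \<open>B\<close> and whose relations are the multiplication
  tables of \<open>A\<close> and \<open>B\<close> together with \<open>h = \<phi> h\<close> for all \<open>h \<in> H\<close>. Its elements are classes of words
  over the disjoint union of the carriers. No formal inverses of letters are needed, because
  each letter has an inverse letter, by the multiplication tables.
\<close>

definition amalg_words ::
    "('a, 'c) monoid_scheme \<Rightarrow> ('b, 'd) monoid_scheme \<Rightarrow> ('a + 'b) list set" where
  "amalg_words A B = lists (carrier A <+> carrier B)"

inductive amalg_eq ::
    "('a, 'c) monoid_scheme \<Rightarrow> ('b, 'd) monoid_scheme \<Rightarrow> 'a set \<Rightarrow> ('a \<Rightarrow> 'b)
      \<Rightarrow> ('a + 'b) list \<Rightarrow> ('a + 'b) list \<Rightarrow> bool"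
  for A B H \<phi> where
  refl: "w \<in> amalg_words A B \<Longrightarrow> amalg_eq A B H \<phi> w w"
| sym: "amalg_eq A B H \<phi> u v \<Longrightarrow> amalg_eq A B H \<phi> v u"
| trans: "amalg_eq A B H \<phi> u v \<Longrightarrow> amalg_eq A B H \<phi> v w \<Longrightarrow> amalg_eq A B H \<phi> u w"
| append: "amalg_eq A B H \<phi> u u' \<Longrightarrow> amalg_eq A B H \<phi> v v' \<Longrightarrow> amalg_eq A B H \<phi> (u @ v) (u' @ v')"
| one_left: "amalg_eq A B H \<phi> [Inl \<one>\<^bsub>A\<^esub>] []"
| one_right: "amalg_eq A B H \<phi> [Inr \<one>\<^bsub>B\<^esub>] []"
| mult_left: "x \<in> carrier A \<Longrightarrow> y \<in> carrier A \<Longrightarrow>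
    amalg_eq A B H \<phi> [Inl x, Inl y] [Inl (x \<otimes>\<^bsub>A\<^esub> y)]"
| mult_right: "x \<in> carrier B \<Longrightarrow> y \<in> carrier B \<Longrightarrow>
    amalg_eq A B H \<phi> [Inr x, Inr y] [Inr (x \<otimes>\<^bsub>B\<^esub> y)]"
| amalgamate: "h \<in> H \<Longrightarrow> amalg_eq A B H \<phi> [Inl h] [Inr (\<phi> h)]"

definition amalg_class ::
    "('a, 'c) monoid_scheme \<Rightarrow> ('b, 'd) monoid_scheme \<Rightarrow> 'a set \<Rightarrow> ('a \<Rightarrow> 'b)
      \<Rightarrow> ('a + 'b) list \<Rightarrow> ('a + 'b) list set" where
  "amalg_class A B H \<phi> w = {v. amalg_eq A B H \<phi> w v}"

definition amalgamated_product ::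
    "('a, 'c) monoid_scheme \<Rightarrow> ('b, 'd) monoid_scheme \<Rightarrow> 'a set \<Rightarrow> ('a \<Rightarrow> 'b)
      \<Rightarrow> ('a + 'b) list set monoid" where
  "amalgamated_product A B H \<phi> =
     \<lparr>carrier = amalg_class A B H \<phi> ` amalg_words A B,
      monoid.mult = (\<lambda>C D. \<Union>u\<in>C. \<Union>v\<in>D. amalg_class A B H \<phi> (u @ v)),
      one = amalg_class A B H \<phi> []\<rparr>"

text \<open>
  The canonical maps from \<open>A\<close> and \<open>B\<close>. By the normal form theorem they are injective if \<open>\<phi>\<close> is an
  isomorphism between subgroups \<open>H\<close> of \<open>A\<close> and \<open>K\<close> of \<open>B\<close>; they are the identification of \<open>A\<close> and \<open>B\<close>
  with subgroups of the amalgamated product.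
\<close>

definition amalg_inl ::
    "('a, 'c) monoid_scheme \<Rightarrow> ('b, 'd) monoid_scheme \<Rightarrow> 'a set \<Rightarrow> ('a \<Rightarrow> 'b)
      \<Rightarrow> 'a \<Rightarrow> ('a + 'b) list set" where
  "amalg_inl A B H \<phi> a = amalg_class A B H \<phi> [Inl a]"

definition amalg_inr ::
    "('a, 'c) monoid_scheme \<Rightarrow> ('b, 'd) monoid_scheme \<Rightarrow> 'a set \<Rightarrow> ('a \<Rightarrow> 'b)
      \<Rightarrow> 'b \<Rightarrow> ('a + 'b) list set" where
  "amalg_inr A B H \<phi> b = amalg_class A B H \<phi> [Inr b]"

section \<open>Separability and isolation with respect to a prime\<close>

definition finite_p_group :: "nat \<Rightarrow> ('x, 'c) monoid_scheme \<Rightarrow> bool" where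
  "finite_p_group p Q \<longleftrightarrow> group Q \<and> finite (carrier Q) \<and> (\<exists>n. order Q = p ^ n)"

definition finite_p_index :: "nat \<Rightarrow> 'x set \<Rightarrow> ('x, 'c) monoid_scheme \<Rightarrow> bool" where
  "finite_p_index p Y G \<longleftrightarrow>
     subgroup Y G \<and> finite (rcosets\<^bsub>G\<^esub> Y) \<and> (\<exists>n. card (rcosets\<^bsub>G\<^esub> Y) = p ^ n)"

text \<open>
  The finite \<open>p\<close>-groups here have their carriers in \<^typ>\<open>nat\<close>. This is no restriction, since
  every finite group is isomorphic to such a group.
\<close>

definition p_separable :: "nat \<Rightarrow> 'x set \<Rightarrow> ('x, 'c) monoid_scheme \<Rightarrow> bool" where
  "p_separable p F G \<longleftrightarrow>
     subgroup F G \<and>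
     (\<forall>g \<in> carrier G - F. \<exists>(Q :: nat monoid) \<psi>.
        finite_p_group p Q \<and> \<psi> \<in> epi G Q \<and> \<psi> g \<notin> \<psi> ` F)"

definition residually_p_finite :: "nat \<Rightarrow> ('x, 'c) monoid_scheme \<Rightarrow> bool" where
  "residually_p_finite p G \<longleftrightarrow> p_separable p {\<one>\<^bsub>G\<^esub>} G"

definition p'_isolated :: "nat \<Rightarrow> 'x set \<Rightarrow> ('x, 'c) monoid_scheme \<Rightarrow> bool" where
  "p'_isolated p Y G \<longleftrightarrow>
     subgroup Y G \<and>
     (\<forall>g \<in> carrier G. \<forall>q :: nat. Factorial_Ring.prime q \<and> q \<noteq> p \<and> g [^]\<^bsub>G\<^esub> q \<in> Y \<longrightarrow> g \<in> Y)"

definition cyclic_subgroup :: "'x set \<Rightarrow> ('x, 'c) monoid_scheme \<Rightarrow> bool" where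
  "cyclic_subgroup Y G \<longleftrightarrow> (\<exists>g \<in> carrier G. Y = generate G {g})"

definition conjugate_subgroups :: "('x, 'c) monoid_scheme \<Rightarrow> 'x set \<Rightarrow> 'x set \<Rightarrow> bool" where
  "conjugate_subgroups G Y Z \<longleftrightarrow> (\<exists>g \<in> carrier G. Z = (\<lambda>y. inv\<^bsub>G\<^esub> g \<otimes>\<^bsub>G\<^esub> y \<otimes>\<^bsub>G\<^esub> g) ` Y)"

text \<open>The families \<open>\<Delta>\<close> and \<open>\<Omega>\<close>, with intersections taken as preimages under the canonical maps.\<close>

definition Delta :: "nat \<Rightarrow> ('x, 'c) monoid_scheme \<Rightarrow> 'x set set" where
  "Delta p G = {F. cyclic_subgroup F G \<and> p'_isolated p F G \<and> \<not> p_separable p F G}"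

definition Omega ::
    "nat \<Rightarrow> ('a, 'c) monoid_scheme \<Rightarrow> ('b, 'd) monoid_scheme \<Rightarrow> 'a set \<Rightarrow> ('a \<Rightarrow> 'b)
      \<Rightarrow> ('a set \<times> 'b set) set" where
  "Omega p A B H \<phi> =
     {({a \<in> carrier A. amalg_inl A B H \<phi> a \<in> N}, {b \<in> carrier B. amalg_inr A B H \<phi> b \<in> N}) | N.
        N \<lhd> amalgamated_product A B H \<phi> \<and> finite_p_index p N (amalgamated_product A B H \<phi>)}"

end

theory Submission
  imports Defs
begin

text \<open>
  Write \<open>Y\<close> for the cyclic subgroup and \<open>g\<close> for its generator. Up to conjugation \<open>g\<close> lies in a factor or
  is a cyclically reduced product \<open>a\<^sub>1 b\<^sub>1 \<dots> a\<^sub>n b\<^sub>n\<close> with no entry in the amalgamated subgroup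
  (\<open>conjugate_form\<close>). The two cases need different arguments, but both rest on one family of finite
  \<open>p\<close>-quotients.

  The quotients. Let \<open>L\<close> be a normal subgroup of \<open>p\<close>-power index. Let the left cosets of \<open>H L\<close> be
  noncommuting variables, and let \<open>t\<close> be the variable \<open>H L\<close>. The group acts on integer power series in these
  variables: \<open>A\<close> permutes the variables by left multiplication, and \<open>B\<close> acts in the same way,
  conjugated by left multiplication with \<open>1 + t\<close>. The two actions agree on \<open>H\<close>, which fixes \<open>t\<close>.
  Truncating the series at a finite degree and reducing coefficients modulo \<open>p\<^sup>e\<close> gives a finite
  quotient. It is a \<open>p\<close>-group, because \<open>L\<close> acts unipotently for the degree filtration
  (\<open>p_normal_congruence_kernel\<close>). As in Magnus's proof that free groups are residually nilpotent, a reduced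
  product whose entries stay outside \<open>H L\<close> moves the constant series \<open>1\<close> (\<open>word_moves_unit_series\<close>). By
  the separability of \<open>H\<close> in the factors, and by the assumption that links \<open>\<Omega>\<close> to the subgroups of the
  factors, a suitable \<open>L\<close> exists for each reduced product.

  If \<open>g\<close> lies in a factor, say in \<open>A\<close>, then \<open>Y\<close> is separable in \<open>A\<close> since it is not in \<open>\<Delta>\<close>, and the
  assumption on \<open>\<Omega>\<close> lifts this to a separation of \<open>Y\<close> from the other elements of \<open>A\<close>. An element
  outside \<open>A\<close> can be separated from all of \<open>A\<close>: the subgroup \<open>A\<close> fixes the series \<open>1\<close>, the element
  moves it (\<open>A_separated\<close>). Since \<open>A\<close> is residually \<open>p\<close>-finite, so is the whole group
  (\<open>residually_p\<close>).

  If \<open>g\<close> is cyclically reduced, suppose that \<open>x\<close> cannot be separated from \<open>Y\<close>. Then \<open>x\<close> is congruent to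
  some \<open>g\<^sup>k\<close> modulo each normal subgroup of \<open>p\<close>-power index, with \<open>k\<close> depending on that subgroup. After
  passing to powers in \<open>L\<close>, the lowest degree in which \<open>g\<close> changes the series \<open>1\<close> carries a nonzero integer
  coefficient that grows linearly with the exponent. Comparing coefficients gives \<open>k n \<equiv> m\<close> modulo
  arbitrarily high powers of \<open>p\<close>, with fixed integers \<open>m\<close> and \<open>n \<noteq> 0\<close> (\<open>exponent_congruence\<close>). After
  division by a power of \<open>p\<close> the exponent \<open>n\<close> is prime to \<open>p\<close>, and residual \<open>p\<close>-finiteness turns the
  congruences into the equation \<open>x\<^sup>n = g\<^sup>m\<close> (\<open>coprime_power_in_closure\<close>). Since \<open>Y\<close> is \<open>p'\<close>-isolated,
  \<open>x\<close> lies in \<open>Y\<close>.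
\<close>

section \<open>Normal subgroups of p-power index\<close>

definition p_normal :: "nat \<Rightarrow> 'x set \<Rightarrow> ('x, 'c) monoid_scheme \<Rightarrow> bool" where
  "p_normal p N G \<longleftrightarrow> N \<lhd> G \<and> finite_p_index p N G"

lemma (in group) coprime_pow_eq_one:
  assumes "x \<in> carrier G" "x [^] (m::nat) = \<one>" "x [^] (n::nat) = \<one>" "coprime m n"
  shows "x = \<one>"
proof -
  have "ord x dvd m" "ord x dvd n"
    using assms pow_eq_id by auto
  then have "ord x = 1"
    using assms(4) by (metis coprime_common_divisor_nat)
  then show ?thesis
    using assms(1) ord_eq_1 by blast
qed

text \<open>
  A prime divisor \<open>q \<noteq> p\<close> of the order would give, by Sylow's theorem, a nontrivial element whose
  \<open>q\<close>-th power is \<open>1\<close>, against the hypothesis on \<open>p\<close>-powers.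
\<close>
lemma (in group) order_prime_power:
  assumes p: "Factorial_Ring.prime p" and fin: "finite (carrier G)"
    and pow: "\<And>x. x \<in> carrier G \<Longrightarrow> \<exists>j. x [^] (p ^ j :: nat) = \<one>"
  shows "\<exists>n. order G = p ^ n"
proof -
  have "order G > 0"
    using fin order_gt_0_iff_finite by simp
  then obtain r where r: "order G = p ^ multiplicity p (order G) * r" "\<not> p dvd r"
    using multiplicity_decompose'[of "order G" p] p by (metis not_prime_unit less_not_refl)
  have "r = 1"
  proof (rule ccontr)
    assume "r \<noteq> 1"
    then obtain q where q: "Factorial_Ring.prime q" "q dvd r"
      using prime_factor_nat by blast
    have "q \<noteq> p" using q r by auto
    obtain m where m: "order G = q ^ 1 * m"
      using q r(1) by (metis dvd_def dvd_mult power_one_right)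
    obtain S where S: "subgroup S G" "card S = q ^ 1"
      using sylow_thm[OF q(1) is_group m fin] by auto
    interpret S: group "G\<lparr>carrier := S\<rparr>"
      using S(1) subgroup.subgroup_is_group is_group by blast
    have "card S > 1" using S(2) q(1) prime_gt_1_nat by simp
    then obtain x where x: "x \<in> S" "x \<noteq> \<one>"
      by (metis card_le_Suc0_iff_eq S(2) One_nat_def not_le card.infinite zero_less_one order_less_asym subgroup.one_closed S(1))
    have "x [^]\<^bsub>G\<lparr>carrier := S\<rparr>\<^esub> order (G\<lparr>carrier := S\<rparr>) = \<one>"
      using S.pow_order_eq_1 x by simp
    then have "x [^] q = \<one>"
      using S by (simp add: order_def nat_pow_consistent[symmetric])
    moreover obtain j where "x [^] (p ^ j :: nat) = \<one>"
      using pow x(1) S(1) subgroup.mem_carrier by meson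
    moreover have "coprime q (p ^ j)"
      using p q(1) \<open>q \<noteq> p\<close> by (simp add: primes_coprime)
    ultimately have "x = \<one>"
      using coprime_pow_eq_one x(1) S(1) subgroup.mem_carrier by meson
    then show False using x by simp
  qed
  then show ?thesis using r by auto
qed

text \<open>
  The working criterion for \<open>p\<close>-power index: the index is finite because \<open>\<Phi>\<close> separates the cosets,
  and it is a power of \<open>p\<close> because every element of the quotient has \<open>p\<close>-power order. This avoids
  counting cosets.
\<close>
lemma (in group) p_normalI:
  assumes p: "Factorial_Ring.prime p" and N: "N \<lhd> G"
    and fin: "finite (\<Phi> ` carrier G)"
    and inj: "\<And>x y. x \<in> carrier G \<Longrightarrow> y \<in> carrier G \<Longrightarrow> \<Phi> x = \<Phi> y \<Longrightarrow> x \<otimes> inv y \<in> N"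
    and pow: "\<And>x. x \<in> carrier G \<Longrightarrow> \<exists>j. x [^] (p ^ j :: nat) \<in> N"
  shows "p_normal p N G"
proof -
  interpret N: normal N G by (rule N)
  interpret Q: group "G Mod N" by (rule N.factorgroup_is_group)
  have eq: "N #> x = N #> y" if "x \<in> carrier G" "y \<in> carrier G" "\<Phi> x = \<Phi> y" for x y
  proof -
    have "x \<in> N #> y"
      using inj[OF that] that(1,2) unfolding r_coset_def
      by (force simp: m_assoc)
    then show ?thesis
      using that N.is_subgroup repr_independence by metis
  qed
  have "rcosets N \<subseteq> (\<lambda>v. N #> (SOME x. x \<in> carrier G \<and> \<Phi> x = v)) ` \<Phi> ` carrier G"
  proof
    fix C assume "C \<in> rcosets N"
    then obtain x where x: "x \<in> carrier G" "C = N #> x"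
      unfolding RCOSETS_def by auto
    let ?y = "SOME y. y \<in> carrier G \<and> \<Phi> y = \<Phi> x"
    have "?y \<in> carrier G \<and> \<Phi> ?y = \<Phi> x"
      by (rule someI[of _ x]) (use x in auto)
    then have "C = N #> ?y" using x eq by metis
    then show "C \<in> (\<lambda>v. N #> (SOME x. x \<in> carrier G \<and> \<Phi> x = v)) ` \<Phi> ` carrier G"
      using x(1) by blast
  qed
  then have finQ: "finite (rcosets N)"
    using fin by (meson finite_imageI finite_subset)
  have "\<exists>n. order (G Mod N) = p ^ n"
  proof (rule Q.order_prime_power[OF p])
    show "finite (carrier (G Mod N))" using finQ by (simp add: FactGroup_def)
    fix C assume "C \<in> carrier (G Mod N)"
    then obtain x where x: "x \<in> carrier G" "C = N #> x"
      unfolding FactGroup_def RCOSETS_def by auto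
    obtain j where "x [^] (p ^ j :: nat) \<in> N" using pow x by blast
    then have "C [^]\<^bsub>G Mod N\<^esub> (p ^ j :: nat) = \<one>\<^bsub>G Mod N\<^esub>"
      using x by (simp add: N.FactGroup_pow coset_join2[OF _ N.is_subgroup])
    then show "\<exists>j. C [^]\<^bsub>G Mod N\<^esub> (p ^ j :: nat) = \<one>\<^bsub>G Mod N\<^esub>" ..
  qed
  then show ?thesis
    using finQ N N.is_subgroup
    unfolding p_normal_def finite_p_index_def order_def FactGroup_def by simp
qed

lemma (in group) p_normal_pow:
  assumes "p_normal p N G"
  obtains r where "\<And>x. x \<in> carrier G \<Longrightarrow> x [^] (p ^ r :: nat) \<in> N"
proof -
  interpret N: normal N G using assms p_normal_def by blast
  interpret Q: group "G Mod N" by (rule N.factorgroup_is_group)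
  obtain r where r: "order (G Mod N) = p ^ r"
    using assms unfolding p_normal_def finite_p_index_def by (auto simp: order_def FactGroup_def)
  show thesis
  proof (rule that[of r])
    fix x assume x: "x \<in> carrier G"
    have "N #> x \<in> carrier (G Mod N)"
      using x by (auto simp: FactGroup_def RCOSETS_def)
    from Q.pow_order_eq_1[OF this]
    have "N #> (x [^] (p ^ r :: nat)) = \<one>\<^bsub>G Mod N\<^esub>"
      using r x N.FactGroup_pow[OF x, of "p ^ r"] by simp
    then show "x [^] (p ^ r :: nat) \<in> N"
      using x N.is_subgroup rcos_self by (metis nat_pow_closed one_FactGroup)
  qed
qed

lemma p_normal_finite: "p_normal p N G \<Longrightarrow> finite (rcosets\<^bsub>G\<^esub> N)"
  unfolding p_normal_def finite_p_index_def by simp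

lemma (in group) rcoset_eqD:
  assumes "subgroup N G" "x \<in> carrier G" "y \<in> carrier G" "N #> x = N #> y"
  shows "x \<otimes> inv y \<in> N"
proof -
  have "x \<in> N #> y" using assms rcos_self by metis
  then obtain n where "n \<in> N" "x = n \<otimes> y" unfolding r_coset_def by auto
  then show ?thesis
    using assms subgroup.mem_carrier[OF assms(1)] by (simp add: m_assoc)
qed

lemma (in group) p_normal_Int:
  assumes p: "Factorial_Ring.prime p" and M: "p_normal p M G" and N: "p_normal p N G"
  shows "p_normal p (M \<inter> N) G"
proof (rule p_normalI[OF p, where \<Phi> = "\<lambda>x. (M #> x, N #> x)"])
  have sub: "subgroup M G" "subgroup N G"
    using M N unfolding p_normal_def finite_p_index_def by auto
  show "M \<inter> N \<lhd> G"
    using M N normal_subgroup_intersect unfolding p_normal_def by blast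
  have "(\<lambda>x. (M #> x, N #> x)) ` carrier G \<subseteq> (rcosets M) \<times> (rcosets N)"
    unfolding RCOSETS_def by auto
  then show "finite ((\<lambda>x. (M #> x, N #> x)) ` carrier G)"
    using p_normal_finite[OF M] p_normal_finite[OF N] by (meson finite_SigmaI finite_subset)
  show "x \<otimes> inv y \<in> M \<inter> N"
    if "x \<in> carrier G" "y \<in> carrier G" "(M #> x, N #> x) = (M #> y, N #> y)" for x y
    using that rcoset_eqD sub by auto
  obtain r where r: "\<And>x. x \<in> carrier G \<Longrightarrow> x [^] (p ^ r :: nat) \<in> M"
    using p_normal_pow[OF M] by blast
  obtain r' where r': "\<And>x. x \<in> carrier G \<Longrightarrow> x [^] (p ^ r' :: nat) \<in> N"
    using p_normal_pow[OF N] by blast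
  fix x assume x: "x \<in> carrier G"
  have "x [^] (p ^ (r' + r) :: nat) = (x [^] (p ^ r' :: nat)) [^] (p ^ r :: nat)"
       "x [^] (p ^ (r' + r) :: nat) = (x [^] (p ^ r :: nat)) [^] (p ^ r' :: nat)"
    using x by (simp_all add: nat_pow_pow power_add mult.commute)
  then have "x [^] (p ^ (r' + r) :: nat) \<in> M \<inter> N"
    using r r' x by (metis IntI nat_pow_closed)
  then show "\<exists>j. x [^] (p ^ j :: nat) \<in> M \<inter> N" ..
qed

lemma (in group) p_normal_carrier:
  assumes p: "Factorial_Ring.prime p"
  shows "p_normal p (carrier G) G"
  by (rule p_normalI[OF p, where \<Phi> = "\<lambda>_. ()"]) (auto simp: normal_inv_iff subgroup_self)

lemma (in group) finite_p_group_kernel: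
  assumes p: "Factorial_Ring.prime p" and Q: "finite_p_group p Q" and \<psi>: "\<psi> \<in> hom G Q"
  shows "p_normal p (kernel G Q \<psi>) G"
proof -
  interpret Q: group Q using Q finite_p_group_def by auto
  interpret group_hom G Q \<psi> using \<psi> by unfold_locales
  obtain n where n: "order Q = p ^ n" using Q finite_p_group_def by blast
  show ?thesis
  proof (rule p_normalI[OF p, where \<Phi> = \<psi>])
    show "kernel G Q \<psi> \<lhd> G" by (rule normal_kernel)
    show "finite (\<psi> ` carrier G)"
      using Q finite_p_group_def by (metis finite_subset image_subsetI hom_closed)
    show "x \<otimes> inv y \<in> kernel G Q \<psi>" if "x \<in> carrier G" "y \<in> carrier G" "\<psi> x = \<psi> y" for x y
      using that by (simp add: kernel_def)
    fix x assume x: "x \<in> carrier G"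
    then have "x [^] (p ^ n :: nat) \<in> kernel G Q \<psi>"
      using Q.pow_order_eq_1[of "\<psi> x"] n by (simp add: kernel_def hom_nat_pow)
    then show "\<exists>j. x [^] (p ^ j :: nat) \<in> kernel G Q \<psi>" ..
  qed
qed

text \<open>
  The finite \<open>p\<close>-groups in the definition of separability have carriers in \<^typ>\<open>nat\<close>, whereas
  quotients of a group have sets as elements; a bijection with an initial segment of the naturals
  transports the multiplication.
\<close>
lemma (in group) nat_copy_of_finite_group:
  assumes "finite (carrier G)"
  obtains Q :: "nat monoid" and \<theta> where "group Q" "finite (carrier Q)" "order Q = order G"
    "\<theta> \<in> hom G Q" "bij_betw \<theta> (carrier G) (carrier Q)"
proof -
  obtain \<theta> :: "'a \<Rightarrow> nat" where \<theta>: "inj_on \<theta> (carrier G)"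
    using finite_imp_inj_to_nat_seg[OF assms] by auto
  let ?g = "inv_into (carrier G) \<theta>"
  define Q where "Q = \<lparr>carrier = \<theta> ` carrier G, monoid.mult = (\<lambda>a b. \<theta> (?g a \<otimes> ?g b)), one = \<theta> \<one>\<rparr>"
  have iso: "\<theta> \<in> iso G Q"
    using \<theta> by (auto simp: iso_def hom_def Q_def bij_betw_def)
  have "Group.monoid Q"
    by unfold_locales (use \<theta> in \<open>auto simp: Q_def m_assoc\<close>)
  then have "group Q"
    using iso iso_imp_group is_isoI by blast
  then show thesis
    using that[of Q \<theta>] iso assms iso_same_card[of G Q]
    by (auto simp: iso_def order_def is_iso_def Q_def card_image[OF \<theta>])
qed

text \<open>
  Replacing homomorphisms by their kernels turns separability into a statement about subgroups of
  the group itself: \<open>x\<close> avoids some \<open>F N\<close>.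
\<close>
lemma (in group) p_separable_iff:
  assumes p: "Factorial_Ring.prime p"
  shows "p_separable p F G \<longleftrightarrow> subgroup F G \<and>
    (\<forall>x \<in> carrier G - F. \<exists>N. p_normal p N G \<and> (\<forall>f \<in> F. inv f \<otimes> x \<notin> N))"
proof (intro iffI conjI ballI)
  assume sep: "p_separable p F G"
  then show F: "subgroup F G" unfolding p_separable_def by blast
  fix x assume x: "x \<in> carrier G - F"
  then obtain Q :: "nat monoid" and \<psi>
    where Q: "finite_p_group p Q" "\<psi> \<in> epi G Q" "\<psi> x \<notin> \<psi> ` F"
    using sep unfolding p_separable_def by blast
  have hom: "\<psi> \<in> hom G Q" using Q(2) by (simp add: epi_def)
  interpret Q: group Q using Q(1) finite_p_group_def by auto
  interpret group_hom G Q \<psi> using hom by unfold_locales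
  have "inv f \<otimes> x \<notin> kernel G Q \<psi>" if "f \<in> F" for f
  proof
    have f: "f \<in> carrier G" using that F subgroup.mem_carrier by metis
    assume "inv f \<otimes> x \<in> kernel G Q \<psi>"
    then have "inv\<^bsub>Q\<^esub> (\<psi> f) \<otimes>\<^bsub>Q\<^esub> \<psi> x = \<one>\<^bsub>Q\<^esub>"
      using x f by (simp add: kernel_def)
    then have "\<psi> x = \<psi> f"
      using x f by (metis DiffD1 Q.inv_closed Q.inv_equality Q.inv_inv hom_closed)
    then show False using Q(3) that by auto
  qed
  then show "\<exists>N. p_normal p N G \<and> (\<forall>f \<in> F. inv f \<otimes> x \<notin> N)"
    using finite_p_group_kernel[OF p Q(1) hom] by blast
next
  assume *: "subgroup F G \<and>
    (\<forall>x \<in> carrier G - F. \<exists>N. p_normal p N G \<and> (\<forall>f \<in> F. inv f \<otimes> x \<notin> N))"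
  show "p_separable p F G"
    unfolding p_separable_def
  proof (intro conjI ballI)
    show "subgroup F G" using * by blast
    fix x assume x: "x \<in> carrier G - F"
    then obtain N where N: "p_normal p N G" "\<And>f. f \<in> F \<Longrightarrow> inv f \<otimes> x \<notin> N"
      using * by blast
    interpret N: normal N G using N(1) p_normal_def by blast
    interpret Q: group "G Mod N" by (rule N.factorgroup_is_group)
    have "finite (carrier (G Mod N))"
      using p_normal_finite[OF N(1)] by (simp add: FactGroup_def)
    then obtain Q :: "nat monoid" and \<theta> where Q: "group Q" "finite (carrier Q)"
      "order Q = order (G Mod N)" "\<theta> \<in> hom (G Mod N) Q"
      "bij_betw \<theta> (carrier (G Mod N)) (carrier Q)"
      using Q.nat_copy_of_finite_group by blast
    let ?\<psi> = "\<theta> \<circ> (\<lambda>x. N #> x)"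
    have hom: "?\<psi> \<in> hom G Q"
      using N.r_coset_hom_Mod Q(4) by (auto simp: hom_def Pi_iff)
    have im: "(\<lambda>x. N #> x) ` carrier G = carrier (G Mod N)"
      by (auto simp: FactGroup_def RCOSETS_def)
    have "?\<psi> \<in> epi G Q"
      using hom Q(5) im unfolding epi_def bij_betw_def by (simp add: image_comp[symmetric] del: comp_apply)
    moreover have "finite_p_group p Q"
      using Q N(1) unfolding finite_p_group_def p_normal_def finite_p_index_def
      by (simp add: order_def FactGroup_def)
    moreover have "?\<psi> x \<notin> ?\<psi> ` F"
    proof
      assume "?\<psi> x \<in> ?\<psi> ` F"
      then obtain f where f: "f \<in> F" "\<theta> (N #> x) = \<theta> (N #> f)" by auto
      have fc: "f \<in> carrier G" using f(1) * subgroup.mem_carrier by metis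
      have "N #> x = N #> f"
        using f(2) Q(5) im x fc unfolding bij_betw_def by (metis DiffD1 imageI inj_onD)
      then have "x \<otimes> inv f \<in> N" using rcoset_eqD N.is_subgroup x fc by blast
      then have "inv f \<otimes> (x \<otimes> inv f) \<otimes> f \<in> N"
        using fc N.inv_op_closed1 by blast
      then have "inv f \<otimes> x \<in> N" using x fc by (simp add: m_assoc)
      then show False using N(2) f(1) by blast
    qed
    ultimately show "\<exists>(Q :: nat monoid) \<psi>. finite_p_group p Q \<and> \<psi> \<in> epi G Q \<and> \<psi> x \<notin> \<psi> ` F"
      by blast
  qed
qed

section \<open>The universal property of the amalgamated product\<close>

text \<open>
  Only three facts about the amalgamated product enter the argument: it is a group, it is generated
  by the images of the factors, and it has the universal property of a pushout. All three can be
  read off from the presentation.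
\<close>
locale amalgam_presentation =
  A: group A + B: group B
  for A :: "('a, 'c) monoid_scheme" and B :: "('b, 'd) monoid_scheme" +
  fixes H :: "'a set" and K :: "'b set" and \<phi> :: "'a \<Rightarrow> 'b"
  assumes sub_H: "subgroup H A" and sub_K: "subgroup K B"
    and iso_\<phi>: "\<phi> \<in> iso (A\<lparr>carrier := H\<rparr>) (B\<lparr>carrier := K\<rparr>)"
begin

abbreviation "P \<equiv> amalgamated_product A B H \<phi>"
abbreviation "\<iota>\<^sub>A \<equiv> amalg_inl A B H \<phi>"
abbreviation "\<iota>\<^sub>B \<equiv> amalg_inr A B H \<phi>"
abbreviation "cls \<equiv> amalg_class A B H \<phi>"
abbreviation "W \<equiv> amalg_words A B"

lemma \<phi>_K: "\<phi> ` H = K"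
  using iso_\<phi> by (auto simp: iso_def bij_betw_def)

lemma H_A: "h \<in> H \<Longrightarrow> h \<in> carrier A"
  using sub_H subgroup.mem_carrier by metis

lemma K_B: "k \<in> K \<Longrightarrow> k \<in> carrier B"
  using sub_K subgroup.mem_carrier by metis

lemma \<phi>_B: "h \<in> H \<Longrightarrow> \<phi> h \<in> carrier B"
  using \<phi>_K K_B by blast

lemma append_words: "u @ v \<in> W \<longleftrightarrow> u \<in> W \<and> v \<in> W"
  by (auto simp: amalg_words_def)

lemma Nil_words: "[] \<in> W"
  by (simp add: amalg_words_def)

lemma Cons_words: "l # w \<in> W \<longleftrightarrow> l \<in> carrier A <+> carrier B \<and> w \<in> W"
  by (auto simp: amalg_words_def)

lemma letter_words:
  "a \<in> carrier A \<Longrightarrow> [Inl a] \<in> W" "b \<in> carrier B \<Longrightarrow> [Inr b] \<in> W"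
  by (auto simp: amalg_words_def)

lemma amalg_eq_words: "amalg_eq A B H \<phi> u v \<Longrightarrow> u \<in> W \<and> v \<in> W"
  by (induction rule: amalg_eq.induct)
    (auto simp: append_words Nil_words Cons_words H_A \<phi>_B)

lemma class_eq_iff:
  assumes "u \<in> W"
  shows "cls u = cls v \<longleftrightarrow> amalg_eq A B H \<phi> u v"
  unfolding amalg_class_def
  using assms amalg_eq.refl amalg_eq.sym amalg_eq.trans by blast

lemma class_mult:
  assumes "u \<in> W" "v \<in> W"
  shows "cls u \<otimes>\<^bsub>P\<^esub> cls v = cls (u @ v)"
proof -
  have "cls (u' @ v') = cls (u @ v)" if "u' \<in> cls u" "v' \<in> cls v" for u' v'
  proof -
    have "amalg_eq A B H \<phi> (u @ v) (u' @ v')"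
      using that by (auto simp: amalg_class_def intro: amalg_eq.append)
    then show ?thesis using class_eq_iff assms append_words by metis
  qed
  moreover have "u \<in> cls u" "v \<in> cls v"
    using assms by (auto simp: amalg_class_def intro: amalg_eq.refl)
  ultimately have "(\<Union>u'\<in>cls u. \<Union>v'\<in>cls v. cls (u' @ v')) = cls (u @ v)"
    by blast
  then show ?thesis by (simp add: amalgamated_product_def)
qed

lemma carrier_P: "carrier P = cls ` W"
  by (simp add: amalgamated_product_def)

lemma one_P: "\<one>\<^bsub>P\<^esub> = cls []"
  by (simp add: amalgamated_product_def)

definition letter_inv :: "'a + 'b \<Rightarrow> 'a + 'b" where
  "letter_inv l = (case l of Inl a \<Rightarrow> Inl (inv\<^bsub>A\<^esub> a) | Inr b \<Rightarrow> Inr (inv\<^bsub>B\<^esub> b))"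

lemma letter_inv:
  assumes "l \<in> carrier A <+> carrier B"
  shows "letter_inv l \<in> carrier A <+> carrier B" "cls [letter_inv l, l] = cls []"
proof -
  show w: "letter_inv l \<in> carrier A <+> carrier B"
    using assms by (auto simp: letter_inv_def)
  have "amalg_eq A B H \<phi> [letter_inv l, l] []"
  proof (cases l)
    case (Inl a)
    then have a: "a \<in> carrier A" using assms by auto
    have "amalg_eq A B H \<phi> [Inl (inv\<^bsub>A\<^esub> a), Inl a] [Inl \<one>\<^bsub>A\<^esub>]"
      using amalg_eq.mult_left[of "inv\<^bsub>A\<^esub> a" A a] a by simp
    then show ?thesis
      using amalg_eq.trans[OF _ amalg_eq.one_left] Inl by (simp add: letter_inv_def)
  next
    case (Inr b)
    then have b: "b \<in> carrier B" using assms by auto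
    have "amalg_eq A B H \<phi> [Inr (inv\<^bsub>B\<^esub> b), Inr b] [Inr \<one>\<^bsub>B\<^esub>]"
      using amalg_eq.mult_right[of "inv\<^bsub>B\<^esub> b" B b] b by simp
    then show ?thesis
      using amalg_eq.trans[OF _ amalg_eq.one_right] Inr by (simp add: letter_inv_def)
  qed
  then show "cls [letter_inv l, l] = cls []"
    using class_eq_iff amalg_eq_words by blast
qed

lemma group_P: "group P"
proof (rule groupI)
  show "x \<otimes>\<^bsub>P\<^esub> y \<in> carrier P" if "x \<in> carrier P" "y \<in> carrier P" for x y
    using that by (auto simp: carrier_P class_mult append_words)
  show "\<one>\<^bsub>P\<^esub> \<in> carrier P" by (simp add: carrier_P one_P Nil_words)
  show "x \<otimes>\<^bsub>P\<^esub> y \<otimes>\<^bsub>P\<^esub> z = x \<otimes>\<^bsub>P\<^esub> (y \<otimes>\<^bsub>P\<^esub> z)"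
    if "x \<in> carrier P" "y \<in> carrier P" "z \<in> carrier P" for x y z
    using that by (auto simp: carrier_P class_mult append_words)
  show "\<one>\<^bsub>P\<^esub> \<otimes>\<^bsub>P\<^esub> x = x" if "x \<in> carrier P" for x
    using that by (auto simp: carrier_P one_P class_mult Nil_words)
  have "\<exists>v \<in> W. cls v \<otimes>\<^bsub>P\<^esub> cls w = \<one>\<^bsub>P\<^esub>" if "w \<in> W" for w
    using that
  proof (induction w)
    case Nil
    then show ?case by (intro bexI[of _ "[]"]) (auto simp: class_mult one_P Nil_words)
  next
    case (Cons l w)
    then have l: "l \<in> carrier A <+> carrier B" and w: "w \<in> W"
      by (simp_all add: Cons_words)
    obtain v where v: "v \<in> W" "cls v \<otimes>\<^bsub>P\<^esub> cls w = \<one>\<^bsub>P\<^esub>"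
      using Cons.IH w by blast
    have li: "[letter_inv l] \<in> W" "[l] \<in> W"
      using letter_inv(1)[OF l] l by (simp_all add: Cons_words Nil_words)
    have "cls (v @ [letter_inv l]) \<otimes>\<^bsub>P\<^esub> cls (l # w) = cls (v @ [letter_inv l, l] @ w)"
      using v w l li by (simp add: class_mult append_words Cons_words)
    also have "\<dots> = cls v \<otimes>\<^bsub>P\<^esub> (cls [letter_inv l, l] \<otimes>\<^bsub>P\<^esub> cls w)"
      using v w l letter_inv(1)[OF l] by (simp add: class_mult append_words Cons_words Nil_words)
    also have "\<dots> = cls v \<otimes>\<^bsub>P\<^esub> (cls [] \<otimes>\<^bsub>P\<^esub> cls w)"
      by (simp add: letter_inv(2)[OF l])
    also have "\<dots> = \<one>\<^bsub>P\<^esub>"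
      using v w by (simp add: class_mult Nil_words)
    finally show ?case
      using v(1) li(1) by (meson append_words)
  qed
  then show "\<exists>y \<in> carrier P. y \<otimes>\<^bsub>P\<^esub> x = \<one>\<^bsub>P\<^esub>" if "x \<in> carrier P" for x
    using that by (auto simp: carrier_P)
qed

lemma hom_\<iota>A: "\<iota>\<^sub>A \<in> hom A P"
proof (rule homI)
  show "\<iota>\<^sub>A x \<in> carrier P" if "x \<in> carrier A" for x
    using that by (simp add: amalg_inl_def carrier_P letter_words)
  show "\<iota>\<^sub>A (x \<otimes>\<^bsub>A\<^esub> y) = \<iota>\<^sub>A x \<otimes>\<^bsub>P\<^esub> \<iota>\<^sub>A y" if "x \<in> carrier A" "y \<in> carrier A" for x y
  proof -
    have "cls [Inl x, Inl y] = cls [Inl (x \<otimes>\<^bsub>A\<^esub> y)]"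
      using that amalg_eq.mult_left[OF that] by (subst class_eq_iff) (auto simp: Cons_words Nil_words)
    then show ?thesis
      using that by (simp add: amalg_inl_def class_mult letter_words)
  qed
qed

lemma hom_\<iota>B: "\<iota>\<^sub>B \<in> hom B P"
proof (rule homI)
  show "\<iota>\<^sub>B x \<in> carrier P" if "x \<in> carrier B" for x
    using that by (simp add: amalg_inr_def carrier_P letter_words)
  show "\<iota>\<^sub>B (x \<otimes>\<^bsub>B\<^esub> y) = \<iota>\<^sub>B x \<otimes>\<^bsub>P\<^esub> \<iota>\<^sub>B y" if "x \<in> carrier B" "y \<in> carrier B" for x y
  proof -
    have "cls [Inr x, Inr y] = cls [Inr (x \<otimes>\<^bsub>B\<^esub> y)]"
      using that amalg_eq.mult_right[OF that] by (subst class_eq_iff) (auto simp: Cons_words Nil_words)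
    then show ?thesis
      using that by (simp add: amalg_inr_def class_mult letter_words)
  qed
qed

lemma \<iota>_\<phi>: "h \<in> H \<Longrightarrow> \<iota>\<^sub>A h = \<iota>\<^sub>B (\<phi> h)"
  unfolding amalg_inl_def amalg_inr_def
  by (subst class_eq_iff) (auto intro: amalg_eq.amalgamate letter_words H_A)

lemma P_generated:
  "carrier P = generate P (\<iota>\<^sub>A ` carrier A \<union> \<iota>\<^sub>B ` carrier B)" (is "_ = generate P ?S")
proof
  have S: "?S \<subseteq> carrier P"
    using hom_\<iota>A hom_\<iota>B by (auto simp: hom_def)
  then show "generate P ?S \<subseteq> carrier P" by (rule group.generate_incl[OF group_P])
  have "cls w \<in> generate P ?S" if "w \<in> W" for w
    using that
  proof (induction w)
    case Nil
    then show ?case using generate.one[of P] by (simp add: one_P)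
  next
    case (Cons l w)
    then have l: "l \<in> carrier A <+> carrier B" and w: "w \<in> W" "cls w \<in> generate P ?S"
      by (simp_all add: Cons_words)
    have "cls [l] \<in> ?S"
      using l by (auto simp: amalg_inl_def amalg_inr_def)
    then have "cls [l] \<otimes>\<^bsub>P\<^esub> cls w \<in> generate P ?S"
      by (rule generate.eng[OF generate.incl w(2)])
    then show ?case using l w by (simp add: class_mult Cons_words Nil_words)
  qed
  then show "carrier P \<subseteq> generate P ?S" by (auto simp: carrier_P)
qed

text \<open>
  Evaluation of words in the target group respects each defining relation, so it descends to classes.
\<close>
lemma P_universal:
  assumes Q: "group Q" and f: "f \<in> hom A Q" and g: "g \<in> hom B Q"
    and eq: "\<And>h. h \<in> H \<Longrightarrow> f h = g (\<phi> h)"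
  shows "\<exists>\<theta> \<in> hom P Q. (\<forall>a \<in> carrier A. \<theta> (\<iota>\<^sub>A a) = f a) \<and> (\<forall>b \<in> carrier B. \<theta> (\<iota>\<^sub>B b) = g b)"
proof -
  interpret Q: group Q by (rule Q)
  interpret f: group_hom A Q f using f by unfold_locales
  interpret g: group_hom B Q g using g by unfold_locales
  define ev where "ev w = foldr (\<lambda>l x. case_sum f g l \<otimes>\<^bsub>Q\<^esub> x) w \<one>\<^bsub>Q\<^esub>" for w
  have ev_simps: "ev [] = \<one>\<^bsub>Q\<^esub>" "ev (l # w) = case_sum f g l \<otimes>\<^bsub>Q\<^esub> ev w" for l w
    by (simp_all add: ev_def)
  have ev_closed: "ev w \<in> carrier Q" if "w \<in> W" for w
    using that by (induction w) (auto simp: ev_simps Cons_words)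
  have ev_append: "ev (u @ v) = ev u \<otimes>\<^bsub>Q\<^esub> ev v" if "u \<in> W" "v \<in> W" for u v
    using that by (induction u) (auto simp: ev_simps Cons_words ev_closed Q.m_assoc)
  have ev_cong: "ev u = ev v" if "amalg_eq A B H \<phi> u v" for u v
    using that
  proof (induction rule: amalg_eq.induct)
    case (append u u' v v')
    then show ?case using amalg_eq_words ev_append by metis
  qed (auto simp: ev_simps eq H_A \<phi>_B)
  define \<theta> where "\<theta> C = ev (SOME w. w \<in> C)" for C
  have \<theta>: "\<theta> (cls w) = ev w" if "w \<in> W" for w
  proof -
    have "w \<in> cls w" using that by (simp add: amalg_class_def amalg_eq.refl)
    then have "(SOME v. v \<in> cls w) \<in> cls w" by (rule someI)
    then show ?thesis
      using ev_cong unfolding \<theta>_def amalg_class_def by (metis mem_Collect_eq)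
  qed
  show ?thesis
  proof (intro bexI conjI ballI)
    show "\<theta> \<in> hom P Q"
      by (rule homI) (auto simp: carrier_P class_mult \<theta> append_words ev_append ev_closed)
    show "\<theta> (\<iota>\<^sub>A a) = f a" if "a \<in> carrier A" for a
      using that by (simp add: amalg_inl_def \<theta> letter_words ev_simps)
    show "\<theta> (\<iota>\<^sub>B b) = g b" if "b \<in> carrier B" for b
      using that by (simp add: amalg_inr_def \<theta> letter_words ev_simps)
  qed
qed

end

section \<open>Operators on noncommutative power series\<close>

text \<open>
  Functions from words to integers are formal power series in noncommuting variables indexed by the
  letters. On them \<open>shift t\<close> is left multiplication by \<open>1 + t\<close>, \<open>unshift t\<close> is left multiplication by
  its inverse \<open>1 - t + t\<^sup>2 - \<dots>\<close>, and a permutation of the letters acts by renaming variables. These are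
  the operators of the Magnus embedding of a free group, written without a ring of series.
\<close>
definition permute :: "('t \<Rightarrow> 't) \<Rightarrow> ('t list \<Rightarrow> int) \<Rightarrow> 't list \<Rightarrow> int" where
  "permute \<sigma> f w = f (map \<sigma> w)"

fun shift :: "'t \<Rightarrow> ('t list \<Rightarrow> int) \<Rightarrow> 't list \<Rightarrow> int" where
  "shift t f [] = f []"
| "shift t f (c # w) = f (c # w) + (if c = t then f w else 0)"

fun unshift :: "'t \<Rightarrow> ('t list \<Rightarrow> int) \<Rightarrow> 't list \<Rightarrow> int" where
  "unshift t f [] = f []"
| "unshift t f (c # w) = f (c # w) - (if c = t then unshift t f w else 0)"

lemma unshift_shift: "unshift t (shift t f) = f"
proof
  show "unshift t (shift t f) w = f w" for w by (induction w) auto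
qed

lemma shift_unshift: "shift t (unshift t f) = f"
proof
  show "shift t (unshift t f) w = f w" for w by (cases w) auto
qed

lemma shift_diff: "shift t (\<lambda>w. f w - g w) = (\<lambda>w. shift t f w - shift t g w)"
proof
  show "shift t (\<lambda>w. f w - g w) w = shift t f w - shift t g w" for w by (cases w) auto
qed

lemma unshift_diff: "unshift t (\<lambda>w. f w - g w) = (\<lambda>w. unshift t f w - unshift t g w)"
proof
  show "unshift t (\<lambda>w. f w - g w) w = unshift t f w - unshift t g w" for w
    by (induction w) auto
qed

lemma permute_shift:
  assumes "\<And>c. \<sigma> c = t \<longleftrightarrow> c = t"
  shows "permute \<sigma> (shift t f) = shift t (permute \<sigma> f)"
proof
  show "permute \<sigma> (shift t f) w = shift t (permute \<sigma> f) w" for w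
    using assms by (cases w) (auto simp: permute_def)
qed

text \<open>
  Modulo \<open>q\<close>, the factor \<open>1 + t\<close> does not change the lowest homogeneous component of a series. Only
  words over \<open>T\<close> are inspected, so that later finitely many words of each length matter.
\<close>
lemma shift_low_degree:
  assumes "\<And>w. w \<in> lists T \<Longrightarrow> length w < d \<Longrightarrow> q dvd f w" "v \<in> lists T" "length v \<le> d"
  shows "q dvd shift t f v - f v"
  using assms by (cases v) auto

lemma unshift_low_degree:
  assumes "\<And>w. w \<in> lists T \<Longrightarrow> length w < d \<Longrightarrow> q dvd f w" "v \<in> lists T" "length v \<le> d"
  shows "q dvd unshift t f v - f v"
  using assms(2,3)
proof (induction v)
  case (Cons c v)
  then have "q dvd unshift t f v - f v" "q dvd f v" using assms(1) by auto
  then have "q dvd unshift t f v" by (metis dvd_diff_commute diff_add_cancel dvd_add)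
  then show ?case by simp
qed simp

text \<open>
  The word \<open>z\<close> has a nonzero coefficient, and it cannot be extended to the left, inside the support of
  the series, except by a repetition of its first letter. Such a repetition has to be allowed because
  \<open>(1 + t)\<^sup>-\<^sup>1\<close> contains all powers of \<open>t\<close>. Multiplication by \<open>1 + t\<close> or its inverse, with
  \<open>t\<close> different from the first letter, prolongs a peak by \<open>t\<close>; this is the reason why reduced words
  of a free group act nontrivially.
\<close>
definition peak :: "('t list \<Rightarrow> int) \<Rightarrow> 't list \<Rightarrow> bool" where
  "peak f z \<longleftrightarrow> f z \<noteq> 0 \<and> (\<forall>y d. z = [] \<or> d \<noteq> hd z \<longrightarrow> f (y @ d # z) = 0)"

lemma peakD: "peak f z \<Longrightarrow> z = [] \<or> d \<noteq> hd z \<Longrightarrow> f (y @ d # z) = 0"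
  unfolding peak_def by blast

lemma peak_shift:
  assumes f: "peak f z" and t: "z = [] \<or> t \<noteq> hd z"
  shows "peak (shift t f) (t # z)"
  unfolding peak_def
proof (intro conjI allI impI)
  show "shift t f (t # z) \<noteq> 0"
    using f peakD[OF f t, of "[]"] by (simp add: peak_def)
  fix y d assume "t # z = [] \<or> d \<noteq> hd (t # z)"
  then have "d \<noteq> t" by simp
  then show "shift t f (y @ d # t # z) = 0"
    using peakD[OF f t, of "y @ [d]"] peakD[OF f t, of "tl y @ [d]"] by (cases y) auto
qed

lemma peak_unshift:
  assumes f: "peak f z" and t: "z = [] \<or> t \<noteq> hd z"
  shows "peak (unshift t f) (t # z)"
  unfolding peak_def
proof (intro conjI allI impI)
  have "unshift t f z = f z"
    using t by (cases z) auto
  then show "unshift t f (t # z) \<noteq> 0"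
    using f peakD[OF f t, of "[]"] by (simp add: peak_def)
  fix y d assume "t # z = [] \<or> d \<noteq> hd (t # z)"
  then have "d \<noteq> t" by simp
  then show "unshift t f (y @ d # t # z) = 0"
  proof (induction y)
    case Nil
    then show ?case using peakD[OF f t, of "[d]"] by simp
  next
    case (Cons c y)
    then show ?case using peakD[OF f t, of "c # y @ [d]"] by simp
  qed
qed

lemma peak_permute:
  assumes f: "peak f z" and inverse: "\<And>c. \<sigma> (\<tau> c) = c" "\<And>c. \<tau> (\<sigma> c) = c"
  shows "peak (permute \<sigma> f) (map \<tau> z)"
proof -
  have z: "map \<sigma> (map \<tau> z) = z" by (simp add: map_idI inverse(1))
  have "f (map \<sigma> y @ \<sigma> d # z) = 0" if "map \<tau> z = [] \<or> d \<noteq> hd (map \<tau> z)" for y d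
    using that inverse by (intro peakD[OF f]) (cases z; auto)
  then show ?thesis
    using f z by (simp add: peak_def permute_def)
qed

definition unit_series :: "'t list \<Rightarrow> int" where
  "unit_series w = (if w = [] then 1 else 0)"

lemma peak_unit_series: "peak unit_series []"
  by (simp add: peak_def unit_series_def)

lemma permute_unit_series: "permute \<sigma> unit_series = unit_series"
  by (rule ext) (simp add: permute_def unit_series_def)

definition Perms :: "'x itself \<Rightarrow> ('x \<Rightarrow> 'x) monoid" where
  "Perms _ = \<lparr>carrier = {f. bij f}, monoid.mult = (\<circ>), one = id\<rparr>"

lemma group_Perms: "group (Perms TYPE('x))"
proof (rule groupI)
  show "\<exists>g \<in> carrier (Perms TYPE('x)). g \<otimes>\<^bsub>Perms TYPE('x)\<^esub> f = \<one>\<^bsub>Perms TYPE('x)\<^esub>"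
    if "f \<in> carrier (Perms TYPE('x))" for f
    using that by (intro bexI[of _ "Hilbert_Choice.inv f"])
      (auto simp: Perms_def bij_imp_bij_inv bij_is_inj)
qed (auto simp: Perms_def bij_comp comp_assoc)

text \<open>
  The letters will be cosets in the group \<open>G\<close>, hence of type \<^typ>\<open>'g set\<close>. The type of the operators is
  fixed here because a locale assumption cannot quantify over types.
\<close>
type_synonym 'g series_op = "('g set list \<Rightarrow> int) \<Rightarrow> 'g set list \<Rightarrow> int"

abbreviation Ops :: "'g itself \<Rightarrow> 'g series_op monoid" where
  "Ops _ \<equiv> Perms TYPE('g set list \<Rightarrow> int)"

section \<open>The Magnus action of an amalgam\<close>

text \<open>
  A group \<open>G\<close> generated by subgroups \<open>A\<close> and \<open>B\<close> over a common subgroup \<open>H\<close>, with the universal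
  property of the amalgamated product for actions on series, and such that the normal subgroups
  of \<open>p\<close>-power index of \<open>G\<close> itself separate elements of \<open>A\<close> and \<open>B\<close> from \<open>H\<close> and from \<open>1\<close>. The
  assumptions are symmetric in \<open>A\<close> and \<open>B\<close>, which halves the work.
\<close>
locale p_amalgam = group G for G :: "('g, 'e) monoid_scheme" (structure) +
  fixes p :: nat and A B H :: "'g set"
  assumes p: "Factorial_Ring.prime p"
    and sub_A: "subgroup A G" and sub_B: "subgroup B G" and sub_H: "subgroup H G"
    and H_A: "H \<subseteq> A" and H_B: "H \<subseteq> B"
    and generated: "carrier G = generate G (A \<union> B)"
    and universal: "\<And>f g. f \<in> hom (G\<lparr>carrier := A\<rparr>) (Ops TYPE('g)) \<Longrightarrow>
          g \<in> hom (G\<lparr>carrier := B\<rparr>) (Ops TYPE('g)) \<Longrightarrow> (\<And>h. h \<in> H \<Longrightarrow> f h = g h) \<Longrightarrow>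
          \<exists>\<theta> \<in> hom G (Ops TYPE('g)). (\<forall>a \<in> A. \<theta> a = f a) \<and> (\<forall>b \<in> B. \<theta> b = g b)"
    and sep_A: "\<And>a. a \<in> A - H \<Longrightarrow> \<exists>N. p_normal p N G \<and> (\<forall>h \<in> H. inv h \<otimes> a \<notin> N)"
    and sep_B: "\<And>b. b \<in> B - H \<Longrightarrow> \<exists>N. p_normal p N G \<and> (\<forall>h \<in> H. inv h \<otimes> b \<notin> N)"
    and res_A: "\<And>a. a \<in> A \<Longrightarrow> a \<noteq> \<one> \<Longrightarrow> \<exists>N. p_normal p N G \<and> a \<notin> N"
    and res_B: "\<And>b. b \<in> B \<Longrightarrow> b \<noteq> \<one> \<Longrightarrow> \<exists>N. p_normal p N G \<and> b \<notin> N"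
begin

lemma A_carrier: "a \<in> A \<Longrightarrow> a \<in> carrier G"
  using sub_A subgroup.mem_carrier by metis

lemma B_carrier: "b \<in> B \<Longrightarrow> b \<in> carrier G"
  using sub_B subgroup.mem_carrier by metis

lemma swapped: "p_amalgam G p B A H"
proof (intro p_amalgam.intro p_amalgam_axioms.intro)
  show "carrier G = generate G (B \<union> A)" using generated by (simp add: Un_commute)
  show "\<exists>\<theta> \<in> hom G (Ops TYPE('g)). (\<forall>a \<in> B. \<theta> a = f a) \<and> (\<forall>b \<in> A. \<theta> b = g b)"
    if "f \<in> hom (G\<lparr>carrier := B\<rparr>) (Ops TYPE('g))" "g \<in> hom (G\<lparr>carrier := A\<rparr>) (Ops TYPE('g))"
       "\<And>h. h \<in> H \<Longrightarrow> f h = g h" for f g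
    using universal[OF that(2) that(1)] that(3) by metis
qed (fact is_group p sub_A sub_B sub_H H_A H_B sep_A sep_B res_A res_B)+

end

text \<open>
  Now \<open>L\<close> is a normal subgroup of \<open>p\<close>-power index. The letters are the finitely many left
  cosets of \<open>H L\<close>; the group permutes them by left multiplication, \<open>H\<close> fixes the base letter \<open>H L\<close>, and
  \<open>L\<close> fixes every letter.
\<close>
locale p_amalgam_quotient = p_amalgam +
  fixes L
  assumes L: "p_normal p L G"
begin

lemma normal_L: "L \<lhd> G"
  using L p_normal_def by blast

lemma sub_L: "subgroup L G"
  using normal_L normal_imp_subgroup by blast

lemma L_carrier: "l \<in> L \<Longrightarrow> l \<in> carrier G"
  using sub_L subgroup.mem_carrier by metis

lemma H_carrier: "h \<in> H \<Longrightarrow> h \<in> carrier G"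
  using sub_H subgroup.mem_carrier by metis

text \<open>
  The second branch makes this an action on the whole type, so that no letter has to be excluded
  when words are mapped.
\<close>
definition act :: "'a \<Rightarrow> 'a set \<Rightarrow> 'a set" where
  "act x t = (if t \<subseteq> carrier G then x <# t else t)"

definition base :: "'a set" where
  "base = H <#> L"

definition letters :: "'a set set" where
  "letters = (\<lambda>x. act x base) ` carrier G"

lemma act_one: "act \<one> t = t"
  by (auto simp: act_def lcos_mult_one)

lemma act_mult: "x \<in> carrier G \<Longrightarrow> y \<in> carrier G \<Longrightarrow> act (x \<otimes> y) t = act x (act y t)"
  by (auto simp: act_def lcos_m_assoc l_coset_subset_G)

lemma map_act_one: "map (act \<one>) w = w"
  by (simp add: act_one map_idI)

lemma map_act_mult:
  "x \<in> carrier G \<Longrightarrow> y \<in> carrier G \<Longrightarrow> map (act (x \<otimes> y)) w = map (act x) (map (act y) w)"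
  by (simp add: act_mult)

lemma act_inv: "x \<in> carrier G \<Longrightarrow> act x (act (inv x) t) = t"
  "x \<in> carrier G \<Longrightarrow> act (inv x) (act x t) = t"
  by (simp_all add: act_mult[symmetric] act_one)

lemma base_carrier: "base \<subseteq> carrier G"
  unfolding base_def using set_mult_closed[of H L] H_carrier L_carrier by auto

lemma act_base: "x \<in> carrier G \<Longrightarrow> act x base = (\<lambda>y. x \<otimes> y) ` base"
  using base_carrier by (auto simp: act_def l_coset_def)

lemma act_H: assumes h: "h \<in> H" shows "act h base = base"
proof -
  have sub: "act h base \<subseteq> base" if h: "h \<in> H" for h
  proof -
    have "h \<otimes> (h' \<otimes> l) = (h \<otimes> h') \<otimes> l" if "h' \<in> H" "l \<in> L" for h' l
      using that h H_carrier L_carrier by (simp add: m_assoc)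
    then show ?thesis
      using h subgroup.m_closed[OF sub_H h]
      unfolding act_base[OF H_carrier[OF h]] unfolding base_def set_mult_def by blast
  qed
  have "act h (act (inv h) base) \<subseteq> act h base"
    using sub[of "inv h"] h sub_H H_carrier base_carrier
    by (auto simp: act_def l_coset_def subgroup.m_inv_closed)
  then show ?thesis using sub[OF h] act_inv H_carrier[OF h] by auto
qed

lemma act_base_fix:
  assumes x: "x \<in> carrier G" "act x base = base"
  obtains h where "h \<in> H" "inv h \<otimes> x \<in> L"
proof -
  have "\<one> \<in> base"
    unfolding base_def set_mult_def
    using subgroup.one_closed[OF sub_H] subgroup.one_closed[OF sub_L] by force
  then have "x \<in> base"
    using x act_base[of x] by force
  then obtain h l where "h \<in> H" "l \<in> L" "x = h \<otimes> l"
    unfolding base_def set_mult_def by auto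
  then have "inv h \<otimes> x = l"
    using H_carrier L_carrier by (simp add: m_assoc[symmetric])
  then show thesis using that \<open>h \<in> H\<close> \<open>l \<in> L\<close> by blast
qed

lemma act_L_base:
  assumes l: "l \<in> L" shows "act l base = base"
proof -
  have sub: "act l base \<subseteq> base" if l: "l \<in> L" for l
  proof
    fix y assume "y \<in> act l base"
    then obtain h l' where y: "h \<in> H" "l' \<in> L" "y = l \<otimes> (h \<otimes> l')"
      unfolding act_base[OF L_carrier[OF l]] unfolding base_def set_mult_def by blast
    have "y = h \<otimes> ((inv h \<otimes> l \<otimes> h) \<otimes> l')"
      using y H_carrier L_carrier l by (simp add: m_assoc[symmetric])
    moreover have "(inv h \<otimes> l \<otimes> h) \<otimes> l' \<in> L"
      using y l H_carrier normal.inv_op_closed1[OF normal_L] subgroup.m_closed[OF sub_L] by blast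
    ultimately show "y \<in> base"
      using y(1) unfolding base_def set_mult_def by blast
  qed
  have "act l (act (inv l) base) \<subseteq> act l base"
    using sub[of "inv l"] l sub_L L_carrier base_carrier
    by (auto simp: act_def l_coset_def subgroup.m_inv_closed)
  then show ?thesis using sub[OF l] act_inv L_carrier[OF l] by auto
qed

lemma base_letters: "base \<in> letters"
  unfolding letters_def using act_one[of base] by (metis image_eqI one_closed)

lemma act_letters: "x \<in> carrier G \<Longrightarrow> t \<in> letters \<Longrightarrow> act x t \<in> letters"
  unfolding letters_def by (auto simp: act_mult[symmetric])

lemma act_L:
  assumes l: "l \<in> L" and t: "t \<in> letters" shows "act l t = t"
proof -
  obtain x where x: "x \<in> carrier G" "t = act x base"
    using t letters_def by auto
  have "act l t = act x (act (inv x \<otimes> l \<otimes> x) base)"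
    using x L_carrier[OF l] by (simp flip: act_mult) (simp flip: m_assoc)
  then show ?thesis
    using act_L_base normal.inv_op_closed1[OF normal_L x(1) l] x by simp
qed

lemma finite_letters: "finite letters"
proof -
  have "act x base = act y base" if "x \<in> carrier G" "y \<in> carrier G" "L #> x = L #> y" for x y
  proof -
    have l: "x \<otimes> inv y \<in> L" using that rcoset_eqD[OF sub_L] by blast
    have "act x base = act ((x \<otimes> inv y) \<otimes> y) base"
      using that by (simp add: m_assoc)
    also have "\<dots> = act (x \<otimes> inv y) (act y base)"
      using that by (intro act_mult) auto
    finally have "act x base = act (x \<otimes> inv y) (act y base)" .
    then show ?thesis
      using act_L[OF l] that letters_def by auto
  qed
  then have "letters \<subseteq> (\<lambda>C. act (SOME x. x \<in> carrier G \<and> L #> x = C) base) ` (rcosets L)"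
    unfolding letters_def RCOSETS_def
  proof (intro subsetI, elim imageE)
    fix t x assume *: "\<And>x y. x \<in> carrier G \<Longrightarrow> y \<in> carrier G \<Longrightarrow> L #> x = L #> y \<Longrightarrow> act x base = act y base"
      and x: "t = act x base" "x \<in> carrier G"
    let ?y = "SOME y. y \<in> carrier G \<and> L #> y = L #> x"
    have "?y \<in> carrier G \<and> L #> ?y = L #> x" by (rule someI[of _ x]) (use x in auto)
    then have "t = act ?y base" using * x by metis
    then show "t \<in> (\<lambda>C. act (SOME x. x \<in> carrier G \<and> L #> x = C) base) ` (\<Union>a\<in>carrier G. {L #> a})"
      using x(2) by blast
  qed
  then show ?thesis
    using p_normal_finite[OF L] by (meson finite_imageI finite_subset)
qed

definition rot :: "'a \<Rightarrow> 'a series_op" where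
  "rot x = permute (act (inv x))"

lemma rot_mult: "x \<in> carrier G \<Longrightarrow> y \<in> carrier G \<Longrightarrow> rot (x \<otimes> y) = rot x \<circ> rot y"
  by (rule ext)+ (simp add: rot_def permute_def inv_mult_group map_act_mult del: map_map)

lemma bij_rot: assumes x: "x \<in> carrier G" shows "bij (rot x)"
proof (rule o_bij)
  have one: "rot \<one> = id" by (rule ext)+ (simp add: rot_def permute_def map_act_one)
  show "rot (inv x) \<circ> rot x = id" using rot_mult[of "inv x" x] x one by simp
  show "rot x \<circ> rot (inv x) = id" using rot_mult[of x "inv x"] x one by simp
qed

lemma bij_shift: "bij (shift t)"
  by (rule o_bij[of "unshift t"]) (auto simp: fun_eq_iff unshift_shift shift_unshift)

lemma bij_unshift: "bij (unshift t)"
  by (rule o_bij[of "shift t"]) (auto simp: fun_eq_iff unshift_shift shift_unshift)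

lemma rot_H: assumes h: "h \<in> H" shows "shift base \<circ> rot h \<circ> unshift base = rot h"
proof -
  have "act (inv h) c = base \<longleftrightarrow> c = base" for c
    using act_H[OF h] act_inv[OF H_carrier[OF h]] by metis
  then have "shift base (rot h f) = rot h (shift base f)" for f
    unfolding rot_def by (rule permute_shift[symmetric])
  then show ?thesis by (intro ext) (simp add: shift_unshift)
qed

text \<open>
  The action of \<open>G\<close> on series: \<open>A\<close> renames variables, and \<open>B\<close> renames variables after conjugation with
  \<open>1 + t\<close>, where \<open>t\<close> is the base letter. On \<open>H\<close> both agree because \<open>H\<close> fixes the base letter, so the
  universal property glues them. In other words, \<open>G\<close> is mapped to the semidirect product of a
  free group on the letters with the finite \<open>p\<close>-group \<open>G / L\<close>, and that product acts on the Magnus ring.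
\<close>
definition \<theta> :: "'a \<Rightarrow> 'a series_op" where
  "\<theta> = (SOME \<theta>. \<theta> \<in> hom G (Ops TYPE('a)) \<and> (\<forall>a \<in> A. \<theta> a = rot a) \<and>
          (\<forall>b \<in> B. \<theta> b = shift base \<circ> rot b \<circ> unshift base))"

lemma \<theta>: "\<theta> \<in> hom G (Ops TYPE('a))" "a \<in> A \<Longrightarrow> \<theta> a = rot a"
  "b \<in> B \<Longrightarrow> \<theta> b = shift base \<circ> rot b \<circ> unshift base"
proof -
  have "\<exists>\<theta> \<in> hom G (Ops TYPE('a)). (\<forall>a \<in> A. \<theta> a = rot a) \<and>
      (\<forall>b \<in> B. \<theta> b = shift base \<circ> rot b \<circ> unshift base)"
  proof (rule universal)
    show "rot \<in> hom (G\<lparr>carrier := A\<rparr>) (Ops TYPE('a))"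
      by (rule homI) (auto simp: Perms_def bij_rot A_carrier rot_mult)
    show "(\<lambda>b. shift base \<circ> rot b \<circ> unshift base) \<in> hom (G\<lparr>carrier := B\<rparr>) (Ops TYPE('a))"
    proof (rule homI)
      show "shift base \<circ> rot b \<circ> unshift base \<in> carrier (Ops TYPE('a))"
        if "b \<in> carrier (G\<lparr>carrier := B\<rparr>)" for b
        using that by (auto simp: Perms_def B_carrier intro!: bij_comp bij_rot bij_shift bij_unshift)
    qed (auto simp: Perms_def B_carrier rot_mult fun_eq_iff unshift_shift)
  qed (simp add: rot_H)
  then have "\<theta> \<in> hom G (Ops TYPE('a)) \<and> (\<forall>a \<in> A. \<theta> a = rot a) \<and>
      (\<forall>b \<in> B. \<theta> b = shift base \<circ> rot b \<circ> unshift base)"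
    unfolding \<theta>_def Bex_def by (rule someI_ex)
  then show "\<theta> \<in> hom G (Ops TYPE('a))" "a \<in> A \<Longrightarrow> \<theta> a = rot a"
    "b \<in> B \<Longrightarrow> \<theta> b = shift base \<circ> rot b \<circ> unshift base" by auto
qed

end

section \<open>Congruence quotients of the action\<close>

lemma dvd_diff_trans: "(q::int) dvd a - b \<Longrightarrow> q dvd b - c \<Longrightarrow> q dvd a - c"
  using dvd_add[of q "a - b" "b - c"] by simp

lemma dvd_diff_right: "(q::int) dvd a - b \<Longrightarrow> q dvd b \<Longrightarrow> q dvd a"
  using dvd_add[of q "a - b" b] by simp

lemma (in group) subgroup_nat_pow_closed:
  "subgroup S G \<Longrightarrow> x \<in> S \<Longrightarrow> x [^] (n::nat) \<in> S"
  by (induction n) (auto simp: subgroup.one_closed subgroup.m_closed)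

context p_amalgam
begin

lemma word_induct [consumes 1, case_names one A B mult]:
  assumes "x \<in> carrier G" "Q \<one>" "\<And>a. a \<in> A \<Longrightarrow> Q a" "\<And>b. b \<in> B \<Longrightarrow> Q b"
    "\<And>x y. x \<in> carrier G \<Longrightarrow> y \<in> carrier G \<Longrightarrow> Q x \<Longrightarrow> Q y \<Longrightarrow> Q (x \<otimes> y)"
  shows "Q x"
proof -
  have "x \<in> generate G (A \<union> B)" using assms(1) generated by simp
  then show ?thesis
  proof (induction rule: generate.induct)
    case (inv h)
    then show ?case
      using assms(3,4) subgroup.m_inv_closed[OF sub_A] subgroup.m_inv_closed[OF sub_B] by blast
  next
    case (eng h1 h2)
    then show ?case using assms(5) generated by blast
  qed (use assms in auto)
qed

text \<open>
  A list of pairs \<open>(a\<^sub>i, b\<^sub>i)\<close> stands for \<open>a\<^sub>1 b\<^sub>1 a\<^sub>2 b\<^sub>2 \<dots>\<close>. Pairing the letters makes rotation, powers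
  and the merging of neighbours simple list operations.
\<close>
fun word :: "('g \<times> 'g) list \<Rightarrow> 'g" where
  "word [] = \<one>"
| "word (s # l) = fst s \<otimes> snd s \<otimes> word l"

lemma word_closed: "set l \<subseteq> A \<times> B \<Longrightarrow> word l \<in> carrier G"
  by (induction l) (auto simp: A_carrier B_carrier)

lemma word_append:
  "set l \<subseteq> A \<times> B \<Longrightarrow> set m \<subseteq> A \<times> B \<Longrightarrow> word (l @ m) = word l \<otimes> word m"
  by (induction l) (auto simp: A_carrier B_carrier word_closed m_assoc)

end

context p_amalgam_quotient
begin

lemma \<theta>_mult: "x \<in> carrier G \<Longrightarrow> y \<in> carrier G \<Longrightarrow> \<theta> (x \<otimes> y) f = \<theta> x (\<theta> y f)"
  using hom_mult[OF \<theta>(1)] by (simp add: Perms_def)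

lemma \<theta>_one: "\<theta> \<one> f = f"
  using hom_one[OF \<theta>(1) is_group group_Perms] by (simp add: Perms_def)

lemma \<theta>_diff:
  "x \<in> carrier G \<Longrightarrow> \<theta> x (\<lambda>w. f w - g w) = (\<lambda>w. \<theta> x f w - \<theta> x g w)"
proof (induction x arbitrary: f g rule: word_induct)
  case (B b)
  have "rot b (\<lambda>w. f w - g w) = (\<lambda>w. rot b f w - rot b g w)" for f g
    by (simp add: rot_def permute_def fun_eq_iff)
  then show ?case using B by (simp add: \<theta>(3) unshift_diff shift_diff)
next
  case (A a)
  then show ?case by (simp add: \<theta>(2) rot_def permute_def fun_eq_iff)
qed (simp_all add: \<theta>_one \<theta>_mult)

lemma map_act_letters: "x \<in> carrier G \<Longrightarrow> w \<in> lists letters \<Longrightarrow> map (act x) w \<in> lists letters"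
  by (auto simp: act_letters)

text \<open>
  On lowest homogeneous components, modulo \<open>q\<close>, the group acts only by renaming variables. Hence
  elements of \<open>L\<close> act unipotently with respect to the degree filtration.
\<close>
lemma \<theta>_leading:
  assumes "x \<in> carrier G" "\<And>w. w \<in> lists letters \<Longrightarrow> length w < d \<Longrightarrow> q dvd f w"
    "v \<in> lists letters" "length v \<le> d"
  shows "q dvd \<theta> x f v - f (map (act (inv x)) v)"
  using assms
proof (induction x arbitrary: f v rule: word_induct)
  case one
  then show ?case by (simp add: \<theta>_one map_act_one)
next
  case (A a)
  then show ?case by (simp add: \<theta>(2) rot_def permute_def)
next
  case (B b)
  note b = B_carrier[OF B(1)]
  let ?g = "unshift base f"
  have g: "q dvd ?g w - f w" if "w \<in> lists letters" "length w \<le> d" for w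
    by (rule unshift_low_degree[OF B(2) that])
  have "q dvd rot b ?g w" if w: "w \<in> lists letters" "length w < d" for w
  proof -
    let ?w = "map (act (inv b)) w"
    have "?w \<in> lists letters" "length ?w < d"
      using w map_act_letters[of "inv b" w] b by auto
    then have "q dvd ?g ?w - f ?w" "q dvd f ?w" using g B(2) by auto
    then have "q dvd ?g ?w" by (rule dvd_diff_right)
    then show ?thesis by (simp add: rot_def permute_def)
  qed
  then have "q dvd shift base (rot b ?g) v - rot b ?g v"
    by (rule shift_low_degree[OF _ B(3,4)])
  moreover have "q dvd rot b ?g v - f (map (act (inv b)) v)"
    using g[of "map (act (inv b)) v"] B(3,4) b map_act_letters[of "inv b" v]
    by (simp add: rot_def permute_def)
  ultimately have "q dvd shift base (rot b ?g) v - f (map (act (inv b)) v)"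
    by (rule dvd_diff_trans)
  then show ?case
    using B(1) by (simp add: \<theta>(3))
next
  case (mult x y)
  have y: "q dvd \<theta> y f w - f (map (act (inv y)) w)" if "w \<in> lists letters" "length w \<le> d" for w
    using mult.IH(2)[OF mult.prems(1) that] .
  have low: "q dvd \<theta> y f w" if "w \<in> lists letters" "length w < d" for w
    by (rule dvd_diff_right[OF y mult.prems(1)])
      (use that mult.hyps map_act_letters[of "inv y" w] in auto)
  have "q dvd \<theta> x (\<theta> y f) v - \<theta> y f (map (act (inv x)) v)"
    by (rule mult.IH(1)[OF low mult.prems(2,3)])
  moreover have "q dvd \<theta> y f (map (act (inv x)) v) - f (map (act (inv y)) (map (act (inv x)) v))"
    by (rule y) (use mult map_act_letters[of "inv x" v] in auto)
  ultimately have "q dvd \<theta> x (\<theta> y f) v - f (map (act (inv y)) (map (act (inv x)) v))"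
    by (rule dvd_diff_trans)
  then show ?case
    using mult.hyps by (simp add: \<theta>_mult inv_mult_group map_act_mult del: map_map)
qed

text \<open>
  Equality of series modulo \<open>q\<close> in all degrees below \<open>n\<close>. The elements of \<open>L\<close> that act trivially
  on these truncated series will form the normal subgroup that separates elements.
\<close>
definition agree :: "int \<Rightarrow> nat \<Rightarrow> ('a set list \<Rightarrow> int) \<Rightarrow> ('a set list \<Rightarrow> int) \<Rightarrow> bool" where
  "agree q n f g \<longleftrightarrow> (\<forall>w \<in> lists letters. length w < n \<longrightarrow> q dvd f w - g w)"

lemma agree_refl: "agree q n f f"
  by (simp add: agree_def)

lemma agree_sym: "agree q n f g \<Longrightarrow> agree q n g f"
  unfolding agree_def by (metis dvd_diff_commute)

lemma agree_trans: "agree q n f g \<Longrightarrow> agree q n g h \<Longrightarrow> agree q n f h"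
  unfolding agree_def using dvd_diff_trans by blast

lemma \<theta>_agree:
  assumes x: "x \<in> carrier G" and fg: "agree q n f g"
  shows "agree q n (\<theta> x f) (\<theta> x g)"
  unfolding agree_def
proof (intro ballI impI)
  fix w assume w: "w \<in> lists letters" "length w < n"
  have "q dvd \<theta> x (\<lambda>w. f w - g w) w - (f (map (act (inv x)) w) - g (map (act (inv x)) w))"
    by (rule \<theta>_leading[OF x _ w(1) order_refl]) (use fg w in \<open>auto simp: agree_def\<close>)
  moreover have "q dvd f (map (act (inv x)) w) - g (map (act (inv x)) w)"
    using fg w map_act_letters[of "inv x" w] x by (simp add: agree_def)
  ultimately have "q dvd \<theta> x (\<lambda>w. f w - g w) w" by (rule dvd_diff_right)
  then show "q dvd \<theta> x f w - \<theta> x g w" by (simp add: \<theta>_diff[OF x])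
qed

definition congruence_kernel :: "int \<Rightarrow> nat \<Rightarrow> 'a set" where
  "congruence_kernel q n = {x \<in> L. \<forall>f. agree q n (\<theta> x f) f}"

lemma kernel_carrier: "x \<in> congruence_kernel q n \<Longrightarrow> x \<in> carrier G"
  using L_carrier by (simp add: congruence_kernel_def)

lemma normal_congruence_kernel: "congruence_kernel q n \<lhd> G"
proof -
  have inverse: "agree q n (\<theta> (inv x) f) f" if x: "x \<in> carrier G" "\<And>f. agree q n (\<theta> x f) f" for x f
  proof -
    have "agree q n (\<theta> (x) (\<theta> (inv x) f)) (\<theta> (inv x) f)" using x(2) .
    moreover have "\<theta> x (\<theta> (inv x) f) = f"
      using \<theta>_mult[of x "inv x" f] x(1) \<theta>_one by simp
    ultimately show ?thesis using agree_sym by simp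
  qed
  have sub: "subgroup (congruence_kernel q n) G"
  proof (rule subgroupI)
    show "congruence_kernel q n \<subseteq> carrier G" using kernel_carrier by blast
    have "\<one> \<in> congruence_kernel q n"
      using subgroup.one_closed[OF sub_L] by (simp add: congruence_kernel_def \<theta>_one agree_refl)
    then show "congruence_kernel q n \<noteq> {}" by blast
    show "inv x \<in> congruence_kernel q n" if "x \<in> congruence_kernel q n" for x
      using that inverse L_carrier subgroup.m_inv_closed[OF sub_L]
      by (auto simp: congruence_kernel_def)
    show "x \<otimes> y \<in> congruence_kernel q n"
      if "x \<in> congruence_kernel q n" "y \<in> congruence_kernel q n" for x y
      using that L_carrier subgroup.m_closed[OF sub_L]
      by (auto simp: congruence_kernel_def \<theta>_mult intro: agree_trans)
  qed
  moreover have "x \<otimes> h \<otimes> inv x \<in> congruence_kernel q n"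
    if x: "x \<in> carrier G" and h: "h \<in> congruence_kernel q n" for x h
  proof -
    have "agree q n (\<theta> (x \<otimes> h \<otimes> inv x) f) f" for f
    proof -
      have "agree q n (\<theta> h (\<theta> (inv x) f)) (\<theta> (inv x) f)"
        using h by (simp add: congruence_kernel_def)
      then have "agree q n (\<theta> x (\<theta> h (\<theta> (inv x) f))) (\<theta> x (\<theta> (inv x) f))"
        by (rule \<theta>_agree[OF x])
      moreover have "\<theta> x (\<theta> (inv x) f) = f"
        using \<theta>_mult[of x "inv x" f] x \<theta>_one by simp
      ultimately show ?thesis
        using x kernel_carrier[OF h] by (simp add: \<theta>_mult)
    qed
    then show ?thesis
      using x h normal.inv_op_closed2[OF normal_L] by (simp add: congruence_kernel_def)
  qed
  ultimately show ?thesis by (simp add: normal_inv_iff)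
qed

text \<open>
  Let \<open>u \<in> L\<close> fix \<open>f\<close> in degrees below the length of \<open>v\<close>. In the degree of \<open>v\<close> the powers of \<open>u\<close> then
  act additively: \<open>u\<^sup>k\<close> changes the coefficient at \<open>v\<close> by \<open>k\<close> times the change made by \<open>u\<close>. This has
  two uses. It shows that \<open>L\<close> acts through a \<open>p\<close>-group on truncated series modulo \<open>p\<^sup>e\<close>, and it
  reads off exponents as integers.
\<close>
lemma \<theta>_power:
  assumes u: "u \<in> L" and f: "agree q (length v) (\<theta> u f) f" and v: "v \<in> lists letters"
  shows "q dvd \<theta> (u [^] (k::nat)) f v - f v - int k * (\<theta> u f v - f v)"
proof (induction k)
  case 0
  then show ?case by (simp add: \<theta>_one)
next
  case (Suc k)
  have uc: "u \<in> carrier G" "u [^] k \<in> carrier G" using L_carrier[OF u] by simp_all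
  have "inv (u [^] k) \<in> L"
    using u subgroup.m_inv_closed[OF sub_L] subgroup_nat_pow_closed[OF sub_L] by blast
  then have fix_v: "map (act (inv (u [^] k))) v = v"
    using v act_L by (intro map_idI) auto
  have "q dvd \<theta> (u [^] k) (\<lambda>w. \<theta> u f w - f w) v - (\<theta> u f v - f v)"
    using \<theta>_leading[OF uc(2) _ v order_refl, of q "\<lambda>w. \<theta> u f w - f w"] f fix_v
    by (simp add: agree_def)
  then have "q dvd \<theta> (u [^] Suc k) f v - \<theta> (u [^] k) f v - (\<theta> u f v - f v)"
    using uc by (simp add: \<theta>_diff \<theta>_mult)
  from dvd_add[OF this Suc] show ?case by (simp add: algebra_simps)
qed

text \<open>
  Each further \<open>q\<close>-th power trivialises one more degree.
\<close>
lemma power_in_congruence_kernel: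
  assumes u: "u \<in> L"
  shows "u [^] (q ^ n :: nat) \<in> congruence_kernel (int q) n"
proof (induction n)
  case 0
  then show ?case using u L_carrier by (simp add: congruence_kernel_def agree_def)
next
  case (Suc n)
  let ?u = "u [^] (q ^ n :: nat)"
  have uL: "?u \<in> L" and ag: "\<And>f. agree (int q) n (\<theta> ?u f) f"
    using Suc by (simp_all add: congruence_kernel_def)
  have "agree (int q) (Suc n) (\<theta> (?u [^] q) f) f" for f
    unfolding agree_def
  proof (intro ballI impI)
    fix w assume w: "w \<in> lists letters" "length w < Suc n"
    have "int q dvd \<theta> (?u [^] q) f w - f w - int q * (\<theta> ?u f w - f w)"
      using ag w by (intro \<theta>_power[OF uL]) (auto simp: agree_def)
    then show "int q dvd \<theta> (?u [^] q) f w - f w"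
      using dvd_diff_right dvd_triv_left by blast
  qed
  moreover have "?u [^] q \<in> L" using uL subgroup_nat_pow_closed[OF sub_L] by blast
  ultimately show ?case
    using L_carrier[OF u] by (simp add: congruence_kernel_def nat_pow_pow mult.commute)
qed

lemma p_normal_congruence_kernel: "p_normal p (congruence_kernel (int (p ^ e)) n) G"
proof -
  let ?q = "int (p ^ e)"
  have q0: "?q > 0" using p prime_gt_0_nat by simp
  define W where "W = {w \<in> lists letters. length w < n}"
  have "finite {w. set w \<subseteq> letters \<and> length w \<le> n}"
    by (rule finite_lists_length_le[OF finite_letters])
  then have finW: "finite W"
    by (rule rev_finite_subset) (auto simp: W_def)
  define F where "F = W \<rightarrow>\<^sub>E {0..<?q}"
  have finF: "finite F" unfolding F_def using finW by (intro finite_PiE) auto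
  define res where "res f = (\<lambda>w\<in>W. f w mod ?q)" for f :: "'a set list \<Rightarrow> int"
  have res_F: "res f \<in> F" for f using q0 by (auto simp: res_def F_def)
  have agree_iff: "agree ?q n f g \<longleftrightarrow> res f = res g" for f g
    unfolding agree_def res_def W_def by (auto simp: fun_eq_iff mod_eq_dvd_iff restrict_def)
  have agree_res: "agree ?q n f (res f)" for f
    unfolding agree_iff by (auto simp: res_def)
  \<comment> \<open>A coset of the kernel is determined by the coset of \<open>L\<close> and by the action on the finite set
    of residues; \<open>res\<close> takes the value \<open>undefined\<close> off \<open>W\<close>, where \<open>agree\<close> does not look.\<close>
  define \<Phi> where "\<Phi> x = (L #> x, (\<lambda>f\<in>F. res (\<theta> x f)))" for x
  show ?thesis
  proof (rule p_normalI[OF p normal_congruence_kernel, where \<Phi> = \<Phi>])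
    have "\<Phi> ` carrier G \<subseteq> (rcosets L) \<times> (F \<rightarrow>\<^sub>E F)"
      using res_F by (auto simp: \<Phi>_def RCOSETS_def)
    moreover have "finite ((rcosets L) \<times> (F \<rightarrow>\<^sub>E F))"
      using p_normal_finite[OF L] finF by (simp add: finite_PiE)
    ultimately show "finite (\<Phi> ` carrier G)" by (rule finite_subset)
    fix x y assume xy: "x \<in> carrier G" "y \<in> carrier G" "\<Phi> x = \<Phi> y"
    have "x \<otimes> inv y \<in> L"
      using arg_cong[of _ _ fst, OF xy(3)] by (intro rcoset_eqD[OF sub_L xy(1,2)]) (simp add: \<Phi>_def)
    moreover have "agree ?q n (\<theta> (x \<otimes> inv y) f) f" for f
    proof -
      let ?g = "\<theta> (inv y) f"
      have "agree ?q n (\<theta> x (res ?g)) (\<theta> y (res ?g))"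
        using fun_cong[of _ _ "res ?g", OF arg_cong[of _ _ snd, OF xy(3)]] res_F[of ?g]
        unfolding agree_iff by (simp add: \<Phi>_def)
      then have "agree ?q n (\<theta> x ?g) (\<theta> y ?g)"
        by (rule agree_trans[OF \<theta>_agree[OF xy(1) agree_res]
              agree_trans[OF _ agree_sym[OF \<theta>_agree[OF xy(2) agree_res]]]])
      moreover have "\<theta> y ?g = f" "\<theta> x ?g = \<theta> (x \<otimes> inv y) f"
        using \<theta>_mult[of y "inv y" f] \<theta>_mult[of x "inv y" f] xy \<theta>_one by simp_all
      ultimately show ?thesis by simp
    qed
    ultimately show "x \<otimes> inv y \<in> congruence_kernel ?q n"
      by (simp add: congruence_kernel_def)
  next
    fix x assume x: "x \<in> carrier G"
    obtain r where r: "x [^] (p ^ r :: nat) \<in> L" using p_normal_pow[OF L] x by blast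
    have "x [^] (p ^ r * (p ^ e) ^ n :: nat) \<in> congruence_kernel ?q n"
      using power_in_congruence_kernel[OF r, of "p ^ e" n] x by (simp add: nat_pow_pow)
    then show "\<exists>j. x [^] (p ^ j :: nat) \<in> congruence_kernel ?q n"
      by (metis power_add power_mult)
  qed
qed

lemma \<theta>_A_unit_series: "a \<in> A \<Longrightarrow> \<theta> a unit_series = unit_series"
  by (simp add: \<theta>(2) rot_def permute_unit_series)

text \<open>
  Not in \<open>H L\<close>; equivalently, moving the base letter.
\<close>
definition far :: "'a \<Rightarrow> bool" where
  "far x \<longleftrightarrow> (\<forall>h \<in> H. inv h \<otimes> x \<notin> L)"

lemma act_far: "x \<in> carrier G \<Longrightarrow> far x \<Longrightarrow> act x base \<noteq> base"
  using act_base_fix unfolding far_def by blast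

lemma peak_rot:
  assumes "x \<in> carrier G" "peak f z"
  shows "peak (rot x f) (map (act x) z)"
  unfolding rot_def by (rule peak_permute[OF assms(2)]) (simp_all add: act_inv assms(1))

text \<open>
  If \<open>b\<close> moves the base letter, then conjugating its renaming by \<open>1 + t\<close> contributes two new letters to
  a peak, \<open>b t\<close> and then \<open>t\<close>, and \<open>a\<close> renames the result. If also \<open>a\<close> moves the base letter, the new
  peak does not begin with it and the next syllable can be applied.
\<close>
lemma peak_syllable:
  assumes a: "a \<in> A" and b: "b \<in> B" "far b" and f: "peak f z" and z: "z = [] \<or> hd z \<noteq> base"
  shows "peak (\<theta> (a \<otimes> b) f) (map (act a) (base # map (act b) (base # z)))"
proof -
  have bc: "b \<in> carrier G" using b B_carrier by blast
  have "peak (unshift base f) (base # z)"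
    using f z by (intro peak_unshift) auto
  then have "peak (rot b (unshift base f)) (map (act b) (base # z))"
    by (rule peak_rot[OF bc])
  then have "peak (shift base (rot b (unshift base f))) (base # map (act b) (base # z))"
    by (rule peak_shift) (use act_far[OF bc b(2)] in auto)
  then show ?thesis
    using a b bc by (simp only: \<theta>_mult A_carrier \<theta>(2,3) comp_apply peak_rot)
qed

lemma peak_word:
  assumes "set l \<subseteq> A \<times> B" "\<And>a b. (a, b) \<in> set l \<Longrightarrow> far a \<and> far b"
  shows "\<exists>z \<in> lists letters. peak (\<theta> (word l) unit_series) z \<and> (z = [] \<or> hd z \<noteq> base)"
  using assms
proof (induction l)
  case Nil
  then show ?case using peak_unit_series by (auto simp: \<theta>_one)
next
  case (Cons s l)
  obtain a b where s: "s = (a, b)" by force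
  have ab: "a \<in> A" "b \<in> B" "far a" "far b" using Cons.prems s by auto
  obtain z where z: "z \<in> lists letters" "peak (\<theta> (word l) unit_series) z" "z = [] \<or> hd z \<noteq> base"
    using Cons by auto
  let ?z = "map (act a) (base # map (act b) (base # z))"
  have "peak (\<theta> (a \<otimes> b) (\<theta> (word l) unit_series)) ?z"
    using peak_syllable ab z by blast
  moreover have "\<theta> (word (s # l)) unit_series = \<theta> (a \<otimes> b) (\<theta> (word l) unit_series)"
    using s ab Cons.prems word_closed[of l] by (simp add: \<theta>_mult A_carrier B_carrier)
  moreover have "hd ?z \<noteq> base" using act_far ab A_carrier by simp
  moreover have "?z \<in> lists letters"
    using z(1) ab base_letters act_letters A_carrier B_carrier by auto
  ultimately show ?case by metis
qed

text \<open>
  The product moves the constant series, because its image has a peak at a nonempty word. The first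
  syllable may have an arbitrary \<open>a\<close>, because no further syllable is put in front of it.
\<close>
lemma word_moves_unit_series:
  assumes ab: "a \<in> A" "b \<in> B" "far b"
    and l: "set l \<subseteq> A \<times> B" "\<And>a b. (a, b) \<in> set l \<Longrightarrow> far a \<and> far b"
  shows "\<exists>z \<in> lists letters. \<theta> (word ((a, b) # l)) unit_series z \<noteq> unit_series z"
proof -
  obtain z where z: "z \<in> lists letters" "peak (\<theta> (word l) unit_series) z" "z = [] \<or> hd z \<noteq> base"
    using peak_word[OF l] by blast
  let ?z = "map (act a) (base # map (act b) (base # z))"
  have "peak (\<theta> (a \<otimes> b) (\<theta> (word l) unit_series)) ?z"
    using peak_syllable ab z by blast
  moreover have "\<theta> (word ((a, b) # l)) unit_series = \<theta> (a \<otimes> b) (\<theta> (word l) unit_series)"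
    using ab word_closed[OF l(1)] by (simp add: \<theta>_mult A_carrier B_carrier)
  moreover have "?z \<in> lists letters"
    using z(1) ab base_letters act_letters A_carrier B_carrier by auto
  moreover have "unit_series ?z = 0" by (simp add: unit_series_def)
  ultimately show ?thesis unfolding peak_def by metis
qed

end

section \<open>Reduced words and separation of elements\<close>

lemma (in normal) rcoset_mem_mult:
  "n \<in> H \<Longrightarrow> y \<in> carrier G \<Longrightarrow> H #> (n \<otimes> y) = H #> y"
  using coset_mult_assoc[of H n y] coset_join2[of n H] subset is_subgroup mem_carrier by auto

lemma (in normal) rcoset_eq_iff:
  assumes "x \<in> carrier G" "y \<in> carrier G"
  shows "H #> x = H #> y \<longleftrightarrow> inv y \<otimes> x \<in> H"
proof
  assume "H #> x = H #> y"
  then have "x \<otimes> inv y \<in> H" using rcoset_eqD is_subgroup assms by blast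
  then have "inv y \<otimes> (x \<otimes> inv y) \<otimes> y \<in> H" using assms inv_op_closed1 by blast
  then show "inv y \<otimes> x \<in> H" using assms by (simp add: m_assoc)
next
  assume "inv y \<otimes> x \<in> H"
  then have "y \<otimes> (inv y \<otimes> x) \<otimes> inv y \<in> H" using assms inv_op_closed2 by blast
  then have "x \<otimes> inv y \<in> H" using assms by (simp add: m_assoc[symmetric])
  then have "H #> (x \<otimes> inv y \<otimes> y) = H #> y" using rcoset_mem_mult assms by blast
  then show "H #> x = H #> y" using assms by (simp add: m_assoc)
qed

text \<open>
  Extract the prime factors of the exponent one at a time.
\<close>
lemma (in group) p'_isolated_coprime:
  assumes Y: "p'_isolated p Y G" and p: "Factorial_Ring.prime p"
    and x: "x \<in> carrier G" "x [^] (n::nat) \<in> Y" and n: "\<not> p dvd n"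
  shows "x \<in> Y"
  using x n
proof (induction n arbitrary: x rule: less_induct)
  case (less n)
  show ?case
  proof (cases "n = 1")
    case True
    then show ?thesis using less.prems by simp
  next
    case False
    then obtain q where q: "Factorial_Ring.prime q" "q dvd n" using prime_factor_nat by blast
    then obtain m where m: "n = m * q" by (metis dvd_div_mult_self)
    have n0: "n > 0" using less.prems(3) by (cases n) auto
    then have "m < n" using m q(1) prime_gt_1_nat by fastforce
    have "q \<noteq> p" using q(2) less.prems(3) by blast
    moreover have "(x [^] m) [^] q \<in> Y"
      using less.prems m by (simp add: nat_pow_pow)
    ultimately have "x [^] m \<in> Y"
      using Y q(1) less.prems(1) unfolding p'_isolated_def by blast
    moreover have "\<not> p dvd m" using less.prems(3) m by (metis dvd_mult2)
    ultimately show ?thesis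
      using less.IH[OF \<open>m < n\<close> less.prems(1)] by blast
  qed
qed

context p_amalgam
begin

lemma far_quotient:
  assumes "finite S" "S \<subseteq> (A - H) \<union> (B - H)"
  shows "\<exists>L. p_normal p L G \<and> (\<forall>x \<in> S. \<forall>h \<in> H. inv h \<otimes> x \<notin> L)"
  using assms
proof (induction S rule: finite_induct)
  case empty
  then show ?case using p_normal_carrier[OF p] by blast
next
  case (insert x S)
  then obtain L where L: "p_normal p L G" "\<forall>x \<in> S. \<forall>h \<in> H. inv h \<otimes> x \<notin> L" by blast
  obtain M where M: "p_normal p M G" "\<forall>h \<in> H. inv h \<otimes> x \<notin> M"
    using insert.prems sep_A sep_B by blast
  show ?case
    using p_normal_Int[OF p L(1) M(1)] L(2) M(2) by blast
qed

lemma H_A': "h \<in> H \<Longrightarrow> h \<in> A" and H_B': "h \<in> H \<Longrightarrow> h \<in> B"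
  using H_A H_B by blast+

lemmas A_m_closed = subgroup.m_closed[OF sub_A] and B_m_closed = subgroup.m_closed[OF sub_B]
lemmas A_one = subgroup.one_closed[OF sub_A] and B_one = subgroup.one_closed[OF sub_B]

lemma word_merge_A:
  assumes "set u \<subseteq> A \<times> B" "set v \<subseteq> A \<times> B" "a \<in> A" "b \<in> H" "a' \<in> A" "b' \<in> B"
  shows "word (u @ (a, b) # (a', b') # v) = word (u @ (a \<otimes> b \<otimes> a', b') # v)"
  using assms by (simp add: word_append A_m_closed H_A' H_B' A_carrier B_carrier word_closed m_assoc)

lemma word_merge_B:
  assumes "set u \<subseteq> A \<times> B" "set v \<subseteq> A \<times> B" "a \<in> H" "b \<in> B" "a' \<in> A" "b' \<in> B"
  shows "word (u @ (a', b') # (a, b) # v) = word (u @ (a', b' \<otimes> a \<otimes> b) # v)"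
  using assms by (simp add: word_append B_m_closed H_A' H_B' A_carrier B_carrier word_closed m_assoc)

lemma word_form:
  assumes "x \<in> carrier G"
  shows "\<exists>l a. set l \<subseteq> A \<times> B \<and> a \<in> A \<and> x = word l \<otimes> a"
  using assms
proof (induction x rule: word_induct)
  case one
  then show ?case using A_one by (intro exI[of _ "[]"] exI[of _ \<one>]) simp
next
  case (A a)
  then show ?case by (intro exI[of _ "[]"] exI[of _ a]) (simp add: A_carrier)
next
  case (B b)
  then show ?case
    using A_one by (intro exI[of _ "[(\<one>, b)]"] exI[of _ \<one>]) (simp add: B_carrier)
next
  case (mult x y)
  obtain l a where x: "set l \<subseteq> A \<times> B" "a \<in> A" "x = word l \<otimes> a" using mult.IH(1) by blast
  obtain m c where y: "set m \<subseteq> A \<times> B" "c \<in> A" "y = word m \<otimes> c" using mult.IH(2) by blast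
  show ?case
  proof (cases m)
    case Nil
    then show ?thesis
      using x y by (intro exI[of _ l] exI[of _ "a \<otimes> c"])
        (simp add: A_m_closed A_carrier word_closed m_assoc)
  next
    case (Cons s m')
    obtain a' b' where s: "s = (a', b')" by force
    show ?thesis
      using x y Cons s by (intro exI[of _ "l @ (a \<otimes> a', b') # m'"] exI[of _ c])
        (simp add: word_append A_m_closed A_carrier B_carrier word_closed m_assoc)
  qed
qed

text \<open>
  Take a representation with as few syllables as possible: an entry of \<open>H\<close> between two others could
  be absorbed, which would save a syllable.
\<close>
lemma reduced_form:
  assumes x: "x \<in> carrier G" "x \<notin> A"
  shows "\<exists>a b l c. a \<in> A \<and> b \<in> B - H \<and> set l \<subseteq> (A - H) \<times> (B - H) \<and> c \<in> A \<and>
    x = word ((a, b) # l) \<otimes> c"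
proof -
  define R where "R l \<longleftrightarrow> set l \<subseteq> A \<times> B \<and> (\<exists>c \<in> A. x = word l \<otimes> c)" for l
  obtain l where "R l" and min: "\<And>m. R m \<Longrightarrow> length l \<le> length m"
    using word_form[OF x(1)] ex_has_least_nat[of R _ length] unfolding R_def by metis
  then obtain c where l: "set l \<subseteq> A \<times> B" "c \<in> A" "x = word l \<otimes> c"
    unfolding R_def by blast
  have b: "b \<notin> H" if uv: "l = u @ (a, b) # v" for u a b v
  proof
    assume b: "b \<in> H"
    have uv': "set u \<subseteq> A \<times> B" "set v \<subseteq> A \<times> B" "a \<in> A" using l uv by auto
    show False
    proof (cases v)
      case Nil
      have "x = word u \<otimes> (a \<otimes> b \<otimes> c)"
        using l uv Nil uv' b
        by (simp add: word_append H_A' H_B' A_carrier B_carrier word_closed m_assoc)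
      then have "R u" using uv' b l(2) unfolding R_def by (metis A_m_closed H_A')
      then show False using min uv by fastforce
    next
      case (Cons s w)
      obtain a' b' where s: "s = (a', b')" by force
      have "R (u @ (a \<otimes> b \<otimes> a', b') # w)"
        using word_merge_A[of u w a b a' b'] l uv Cons s b
        unfolding R_def by (auto simp: A_m_closed H_A')
      from min[OF this] show False using uv Cons by simp
    qed
  qed
  have a: "a \<notin> H" if uv: "l = u @ (a', b') # (a, b) # v" for u a' b' a b v
  proof
    assume a: "a \<in> H"
    have "R (u @ (a', b' \<otimes> a \<otimes> b) # v)"
      using word_merge_B[of u v a b a' b'] l uv a
      unfolding R_def by (auto simp: B_m_closed H_B')
    from min[OF this] show False using uv by simp
  qed
  have "l \<noteq> []" using l x(2) A_carrier by auto
  then obtain a0 b0 l' where l0: "l = (a0, b0) # l'" by (metis list.exhaust prod.exhaust)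
  have "set l' \<subseteq> (A - H) \<times> (B - H)"
  proof
    fix s assume "s \<in> set l'"
    then obtain u v where uv: "l' = u @ s # v" by (meson split_list)
    obtain a1 b1 where s: "s = (a1, b1)" by force
    have "b1 \<notin> H" using b[of "(a0, b0) # u" a1 b1 v] l0 uv s by simp
    moreover have "a1 \<notin> H"
    proof (cases u rule: rev_cases)
      case Nil
      then show ?thesis using a[of "[]" a0 b0 a1 b1 v] l0 uv s by simp
    next
      case (snoc u' t)
      obtain a2 b2 where "t = (a2, b2)" by force
      then show ?thesis using a[of "(a0, b0) # u'" a2 b2 a1 b1 v] l0 uv s snoc by simp
    qed
    ultimately show "s \<in> (A - H) \<times> (B - H)" using s l(1) l0 uv by auto
  qed
  moreover have "b0 \<notin> H" using b[of "[]" a0 b0 l'] l0 by simp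
  ultimately show ?thesis using l l0 by auto
qed

text \<open>
  The unit series is fixed by \<open>A\<close>, but an element outside \<open>A\<close> moves it, provided that \<open>L\<close> is chosen
  to keep the finitely many entries of its reduced form outside \<open>H L\<close>. The difference of coefficients
  is a nonzero integer, hence visible modulo a high power of \<open>p\<close>.
\<close>
lemma A_separated:
  assumes x: "x \<in> carrier G" "x \<notin> A"
  shows "\<exists>N. p_normal p N G \<and> (\<forall>a \<in> A. inv a \<otimes> x \<notin> N)"
proof -
  obtain a b l c where form: "a \<in> A" "b \<in> B - H" "set l \<subseteq> (A - H) \<times> (B - H)" "c \<in> A"
    "x = word ((a, b) # l) \<otimes> c"
    using reduced_form[OF x] by blast
  have "finite (insert b (fst ` set l \<union> snd ` set l))" by simp
  moreover have "insert b (fst ` set l \<union> snd ` set l) \<subseteq> (A - H) \<union> (B - H)"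
    using form by auto
  ultimately obtain L where L: "p_normal p L G"
    "\<forall>y \<in> insert b (fst ` set l \<union> snd ` set l). \<forall>h \<in> H. inv h \<otimes> y \<notin> L"
    using far_quotient by meson
  interpret Q: p_amalgam_quotient G p A B H L
    using L(1) by unfold_locales
  have lAB: "set l \<subseteq> A \<times> B" using form by auto
  have far: "Q.far b" "\<And>a b. (a, b) \<in> set l \<Longrightarrow> Q.far a \<and> Q.far b"
    using L(2) unfolding Q.far_def by force+
  obtain z where z: "z \<in> lists Q.letters" "Q.\<theta> (word ((a, b) # l)) unit_series z \<noteq> unit_series z"
    using Q.word_moves_unit_series[OF form(1) _ far(1) lAB far(2)] form(2) by blast
  have wc: "word ((a, b) # l) \<in> carrier G"
    by (rule word_closed) (use form lAB in auto)
  have xz: "Q.\<theta> x unit_series z \<noteq> unit_series z"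
    using z(2) wc form(4) Q.\<theta>_A_unit_series[OF form(4)]
    unfolding form(5) by (simp only: Q.\<theta>_mult A_carrier not_False_eq_True)
  let ?d = "Q.\<theta> x unit_series z - unit_series z"
  obtain e where e: "nat \<bar>?d\<bar> < p ^ e"
    using power_gt_expt[of p] prime_gt_Suc_0_nat[OF p] by blast
  have nd: "\<not> int (p ^ e) dvd ?d"
  proof
    assume "int (p ^ e) dvd ?d"
    then have "int (p ^ e) \<le> \<bar>?d\<bar>" using xz by (intro zdvd_imp_le) auto
    then show False using e by linarith
  qed
  let ?N = "Q.congruence_kernel (int (p ^ e)) (Suc (length z))"
  have "inv a \<otimes> x \<notin> ?N" if a: "a \<in> A" for a
  proof
    assume "inv a \<otimes> x \<in> ?N"
    then have "Q.agree (int (p ^ e)) (Suc (length z)) (Q.\<theta> (inv a \<otimes> x) unit_series) unit_series"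
      by (simp add: Q.congruence_kernel_def)
    from Q.\<theta>_agree[OF A_carrier[OF a] this]
    have "Q.agree (int (p ^ e)) (Suc (length z)) (Q.\<theta> x unit_series) unit_series"
      using a x(1) by (simp add: Q.\<theta>_A_unit_series A_carrier m_assoc[symmetric]
          flip: Q.\<theta>_mult)
    then show False using nd z(1) by (simp add: Q.agree_def)
  qed
  then show ?thesis using Q.p_normal_congruence_kernel by blast
qed

lemma residually_p:
  assumes x: "x \<in> carrier G" "x \<noteq> \<one>"
  shows "\<exists>N. p_normal p N G \<and> x \<notin> N"
proof (cases "x \<in> A")
  case True
  then show ?thesis using res_A x(2) by blast
next
  case False
  then obtain N where "p_normal p N G" "\<forall>a \<in> A. inv a \<otimes> x \<notin> N"
    using A_separated x(1) by blast
  then show ?thesis using A_one x(1) by (metis inv_one l_one)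
qed

text \<open>
  As for reduced forms, but minimising over all conjugates; conjugation allows lists to be rotated,
  so that also the ends of the list have neighbours to be merged with.
\<close>
lemma conjugate_form:
  assumes x: "x \<in> carrier G"
  shows "\<exists>y \<in> carrier G. inv y \<otimes> x \<otimes> y \<in> A \<or> inv y \<otimes> x \<otimes> y \<in> B \<or>
    (\<exists>l. l \<noteq> [] \<and> set l \<subseteq> (A - H) \<times> (B - H) \<and> inv y \<otimes> x \<otimes> y = word l)"
proof -
  define R where "R l \<longleftrightarrow> set l \<subseteq> A \<times> B \<and> (\<exists>y \<in> carrier G. inv y \<otimes> x \<otimes> y = word l)" for l
  have rotate: "R (v @ u)" if "R (u @ v)" for u v
  proof -
    from that obtain y where y: "set u \<subseteq> A \<times> B" "set v \<subseteq> A \<times> B" "y \<in> carrier G"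
      "inv y \<otimes> x \<otimes> y = word u \<otimes> word v"
      unfolding R_def by (auto simp: word_append)
    let ?u = "word u"
    have u: "?u \<in> carrier G" "word v \<in> carrier G" using y word_closed by auto
    have "inv (y \<otimes> ?u) \<otimes> x \<otimes> (y \<otimes> ?u) = inv ?u \<otimes> (inv y \<otimes> x \<otimes> y) \<otimes> ?u"
      using u y(3) x by (simp add: inv_mult_group m_assoc)
    also have "\<dots> = word v \<otimes> word u"
      unfolding y(4) using u by (simp add: m_assoc[symmetric])
    finally show ?thesis
      using y u unfolding R_def by (auto simp: word_append intro!: bexI[of _ "y \<otimes> ?u"])
  qed
  obtain l0 a0 where "set l0 \<subseteq> A \<times> B" "a0 \<in> A" "x = word l0 \<otimes> a0" using word_form[OF x] by blast
  then have "R (l0 @ [(a0, \<one>)])"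
    unfolding R_def using x B_one
    by (auto simp: word_append A_carrier word_closed intro!: bexI[of _ \<one>])
  then obtain l where Rl: "R l" and min: "\<And>m. R m \<Longrightarrow> length l \<le> length m"
    using ex_has_least_nat[of R _ length] by metis
  then obtain y where l: "set l \<subseteq> A \<times> B" "y \<in> carrier G" "inv y \<otimes> x \<otimes> y = word l"
    unfolding R_def by blast
  consider "l = []" | a b where "l = [(a, b)]" | "length l \<ge> 2"
    by (cases l; cases "tl l") auto
  then show ?thesis
  proof cases
    case 1
    then show ?thesis using l A_one by (intro bexI[of _ y]) auto
  next
    case (2 a b)
    then have ab: "a \<in> A" "b \<in> B" "inv y \<otimes> x \<otimes> y = a \<otimes> b"
      using l by (auto simp: A_carrier B_carrier)
    show ?thesis
    proof (cases "a \<in> H \<or> b \<in> H")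
      case True
      then have "a \<otimes> b \<in> A \<or> a \<otimes> b \<in> B" using ab A_m_closed B_m_closed H_A' H_B' by blast
      then show ?thesis using ab l(2) by metis
    next
      case False
      then show ?thesis using ab 2 l by (intro bexI[of _ y] disjI2 exI[of _ l]) auto
    qed
  next
    case 3
    have "set l \<subseteq> (A - H) \<times> (B - H)"
    proof
      fix s assume "s \<in> set l"
      then obtain u v where uv: "l = u @ s # v" by (meson split_list)
      obtain a b where s: "s = (a, b)" by force
      have ab: "a \<in> A" "b \<in> B" and vu: "set (v @ u) \<subseteq> A \<times> B" using l(1) uv s by auto
      have R1: "R ((a, b) # v @ u)" using rotate[of u "(a, b) # v"] Rl uv s by simp
      have R2: "R ((v @ u) @ [(a, b)])" using rotate[of "[(a, b)]" "v @ u"] R1 by simp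
      have "v @ u \<noteq> []" using 3 uv by auto
      have "b \<notin> H"
      proof
        assume b: "b \<in> H"
        obtain a' b' w where w: "v @ u = (a', b') # w"
          using \<open>v @ u \<noteq> []\<close> by (metis list.exhaust prod.exhaust)
        have "R ((a \<otimes> b \<otimes> a', b') # w)"
          using word_merge_A[of "[]" w a b a' b'] R1 ab b vu unfolding w R_def
          by (auto simp: A_m_closed H_A')
        from min[OF this] show False using arg_cong[OF w, of length] uv by simp
      qed
      moreover have "a \<notin> H"
      proof
        assume a: "a \<in> H"
        obtain a' b' w where w: "v @ u = w @ [(a', b')]"
          using \<open>v @ u \<noteq> []\<close> by (metis rev_exhaust prod.exhaust)
        have "R (w @ [(a', b' \<otimes> a \<otimes> b)])"
          using word_merge_B[of w "[]" a b a' b'] R2 ab a vu unfolding w R_def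
          by (auto simp: B_m_closed H_B')
        from min[OF this] show False using arg_cong[OF w, of length] uv by simp
      qed
      ultimately show "s \<in> (A - H) \<times> (B - H)" using ab s by blast
    qed
    then show ?thesis using l 3 by (intro bexI[of _ y] disjI2 exI[of _ l]) auto
  qed
qed

lemma word_power:
  "set l \<subseteq> A \<times> B \<Longrightarrow> word l [^] (n::nat) = word (concat (replicate n l))"
proof (induction n)
  case (Suc n)
  have "set (concat (replicate n l)) \<subseteq> A \<times> B" using Suc.prems by auto
  then show ?case
    using Suc nat_pow_Suc2[OF word_closed[OF Suc.prems], of n] by (simp add: word_append)
qed simp

text \<open>
  The heart of the proof. Suppose that \<open>x\<close> is congruent to a power \<open>g\<^sup>k\<close> modulo every normal subgroup of
  \<open>p\<close>-power index, where \<open>g\<close> is cyclically reduced. The exponent \<open>k\<close> varies with the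
  subgroup, like the digits of a \<open>p\<close>-adic integer. Replace \<open>g\<close> and \<open>x\<close> by powers \<open>w\<close> and \<open>u\<close> in \<open>L\<close>. Being
  cyclically reduced, \<open>g\<close> has reduced powers, so \<open>w\<close> moves the unit series; let \<open>v\<close> be a shortest word at
  which a coefficient changes, and let \<open>n\<close> and \<open>m\<close> be the changes at \<open>v\<close> made by \<open>w\<close> and \<open>u\<close>. Since \<open>w\<^sup>k\<close>
  changes the coefficient by \<open>k n\<close>, it follows that \<open>k n \<equiv> m\<close> modulo \<open>p\<^sup>e\<close> with fixed integers
  \<open>n \<noteq> 0\<close> and \<open>m\<close>: the limit of the exponents is the rational number \<open>m / n\<close>.
\<close>
lemma exponent_congruence:
  assumes l: "l \<noteq> []" "set l \<subseteq> (A - H) \<times> (B - H)" and x: "x \<in> carrier G"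
    and dense: "\<And>N. p_normal p N G \<Longrightarrow> \<exists>k::nat. N #> x = N #> (word l [^] k)"
  shows "\<exists>n m :: int. n \<noteq> 0 \<and> (\<forall>e N. p_normal p N G \<longrightarrow>
    (\<exists>k::nat. N #> x = N #> (word l [^] k) \<and> int p ^ e dvd m - int k * n))"
proof -
  let ?g = "word l"
  have lAB: "set l \<subseteq> A \<times> B" using l by auto
  have gc: "?g \<in> carrier G" by (rule word_closed[OF lAB])
  have "finite (fst ` set l \<union> snd ` set l)" by simp
  moreover have "fst ` set l \<union> snd ` set l \<subseteq> (A - H) \<union> (B - H)"
    using l by auto
  ultimately obtain L where L: "p_normal p L G"
    "\<forall>y \<in> fst ` set l \<union> snd ` set l. \<forall>h \<in> H. inv h \<otimes> y \<notin> L"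
    using far_quotient by meson
  interpret Q: p_amalgam_quotient G p A B H L
    using L(1) by unfold_locales
  obtain r where r: "\<And>y. y \<in> carrier G \<Longrightarrow> y [^] (p ^ r :: nat) \<in> L"
    using p_normal_pow[OF L(1)] by blast
  let ?w = "?g [^] (p ^ r :: nat)" and ?u = "x [^] (p ^ r :: nat)"
  let ?f = "unit_series :: 'g set list \<Rightarrow> int"
  have wc: "?w \<in> carrier G" and uc: "?u \<in> carrier G" using gc x by simp_all
  have "\<exists>z \<in> lists Q.letters. Q.\<theta> ?w ?f z \<noteq> ?f z"
  proof -
    obtain a b m where m: "concat (replicate (p ^ r) l) = (a, b) # m"
    proof -
      have "p ^ r > 0" using p prime_gt_0_nat by simp
      then have "concat (replicate (p ^ r) l) \<noteq> []" using l(1) by (cases "p ^ r") auto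
      then show thesis using that by (metis list.exhaust prod.exhaust)
    qed
    have sub: "set ((a, b) # m) \<subseteq> set l" unfolding m[symmetric] by auto
    have far: "Q.far a \<and> Q.far b" if "(a, b) \<in> set l" for a b
      using L(2) that unfolding Q.far_def by force
    have "?w = word ((a, b) # m)" using word_power[OF lAB] m by simp
    moreover have "\<exists>z \<in> lists Q.letters. Q.\<theta> (word ((a, b) # m)) ?f z \<noteq> ?f z"
      by (rule Q.word_moves_unit_series) (use sub lAB far in auto)
    ultimately show ?thesis by simp
  qed
  then obtain v where v: "v \<in> lists Q.letters" "Q.\<theta> ?w ?f v \<noteq> ?f v"
    and minimal: "\<And>z. z \<in> lists Q.letters \<Longrightarrow> Q.\<theta> ?w ?f z \<noteq> ?f z \<Longrightarrow> length v \<le> length z"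
    using ex_has_least_nat[of "\<lambda>z. z \<in> lists Q.letters \<and> Q.\<theta> ?w ?f z \<noteq> ?f z" _ length] by metis
  define n where "n = Q.\<theta> ?w ?f v - ?f v"
  define m where "m = Q.\<theta> ?u ?f v - ?f v"
  have "\<exists>k::nat. N #> x = N #> (?g [^] k) \<and> int p ^ e dvd m - int k * n"
    if N: "p_normal p N G" for e N
  proof -
    let ?q = "int (p ^ e)"
    let ?C = "Q.congruence_kernel ?q (Suc (length v))"
    have C: "p_normal p ?C G" by (rule Q.p_normal_congruence_kernel)
    interpret N: normal N G using N p_normal_def by blast
    interpret C: normal ?C G using C p_normal_def by blast
    interpret NC: normal "N \<inter> ?C" G using p_normal_Int[OF p N C] p_normal_def by blast
    obtain k :: nat where k: "(N \<inter> ?C) #> x = (N \<inter> ?C) #> (?g [^] k)"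
      using dense[OF p_normal_Int[OF p N C]] by blast
    have gk: "?g [^] k \<in> carrier G" using gc by simp
    have k': "N #> x = N #> (?g [^] k)" "?C #> x = ?C #> (?g [^] k)"
      using k NC.rcoset_eq_iff[OF x gk] N.rcoset_eq_iff[OF x gk] C.rcoset_eq_iff[OF x gk]
      by blast+
    have "?C #> ?u = ?C #> ((?g [^] k) [^] (p ^ r :: nat))"
      using C.FactGroup_pow[OF x, of "p ^ r"] C.FactGroup_pow[of "?g [^] k" "p ^ r"] k'(2) gc
      by simp
    also have "(?g [^] k) [^] (p ^ r :: nat) = ?w [^] k"
      using gc by (simp add: nat_pow_pow mult.commute)
    finally have "inv (?w [^] k) \<otimes> ?u \<in> ?C"
      using C.rcoset_eq_iff uc wc by simp
    then have "Q.agree ?q (Suc (length v)) (Q.\<theta> (inv (?w [^] k) \<otimes> ?u) ?f) ?f"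
      by (simp add: Q.congruence_kernel_def)
    from Q.\<theta>_agree[OF _ this, of "?w [^] k"]
    have "Q.agree ?q (Suc (length v)) (Q.\<theta> (?w [^] k) (Q.\<theta> (inv (?w [^] k) \<otimes> ?u) ?f)) (Q.\<theta> (?w [^] k) ?f)"
      using wc by simp
    moreover have "Q.\<theta> (?w [^] k) (Q.\<theta> (inv (?w [^] k) \<otimes> ?u) ?f) = Q.\<theta> ?u ?f"
    proof -
      have "?w [^] k \<otimes> (inv (?w [^] k) \<otimes> ?u) = ?u"
        using wc uc nat_pow_closed[OF wc, of k] by (simp only: m_assoc[symmetric] inv_closed r_inv l_one)
      then show ?thesis
        using Q.\<theta>_mult[of "?w [^] k" "inv (?w [^] k) \<otimes> ?u" ?f] wc uc nat_pow_closed[OF wc, of k]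
        by (metis inv_closed m_closed)
    qed
    ultimately have 1: "?q dvd Q.\<theta> ?u ?f v - Q.\<theta> (?w [^] k) ?f v"
      using v(1) by (simp add: Q.agree_def)
    have "Q.agree ?q (length v) (Q.\<theta> ?w ?f) ?f"
      unfolding Q.agree_def
    proof (intro ballI impI)
      fix z assume "z \<in> lists Q.letters" "length z < length v"
      then have "Q.\<theta> ?w ?f z = ?f z" using minimal[of z] by (meson not_le)
      then show "?q dvd Q.\<theta> ?w ?f z - ?f z" by simp
    qed
    then have "?q dvd Q.\<theta> (?w [^] k) ?f v - ?f v - int k * n"
      unfolding n_def using r[OF gc] v(1) by (intro Q.\<theta>_power)
    from dvd_add[OF 1 this] have "?q dvd m - int k * n"
      by (simp add: m_def algebra_simps)
    then show ?thesis using k'(1) by auto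
  qed
  moreover have "n \<noteq> 0" using v(2) by (simp add: n_def)
  ultimately show ?thesis by blast
qed

text \<open>
  Cancel the common power of \<open>p\<close> in \<open>k n \<equiv> m\<close>. With the resulting \<open>n'\<close> and \<open>m'\<close>, the elements
  \<open>x\<close> to the \<open>n'\<close> and \<open>g\<close> to the \<open>m'\<close> are congruent modulo all normal subgroups of \<open>p\<close>-power
  index, hence equal by residual \<open>p\<close>-finiteness, and \<open>n'\<close> is prime to \<open>p\<close>.
\<close>
lemma coprime_power_in_closure:
  assumes x: "x \<in> carrier G" and g: "g \<in> carrier G" and n: "n \<noteq> 0"
    and cong: "\<And>e N. p_normal p N G \<Longrightarrow>
      \<exists>k::nat. N #> x = N #> (g [^] k) \<and> int p ^ e dvd m - int k * n"
  shows "\<exists>n'::nat. \<not> p dvd n' \<and> x [^] n' \<in> generate G {g}"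
proof -
  have p0: "int p \<noteq> 0" using p by auto
  obtain n' where n': "n = int p ^ multiplicity (int p) n * n'" "\<not> int p dvd n'"
    using multiplicity_decompose'[of n "int p"] n p by (metis not_prime_unit prime_int_nat_transfer prime_nat_int_transfer)
  define a where "a = multiplicity (int p) n"
  obtain k0 :: nat where "int p ^ a dvd m - int k0 * n"
    using cong[OF p_normal_carrier[OF p]] by blast
  then have "int p ^ a dvd m" using n'(1) unfolding a_def[symmetric]
    by (metis dvd_diff_right dvd_mult dvd_triv_left mult.left_commute)
  then obtain m' where m': "m = int p ^ a * m'" by blast
  have eq: "x [^] n' = g [^] m'"
  proof (rule ccontr)
    assume ne: "x [^] n' \<noteq> g [^] m'"
    then have "inv (g [^] m') \<otimes> x [^] n' \<noteq> \<one>"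
      using x g by (metis int_pow_closed inv_closed inv_equality inv_inv)
    then obtain N where N: "p_normal p N G" "inv (g [^] m') \<otimes> x [^] n' \<notin> N"
      using residually_p x g by (metis int_pow_closed inv_closed m_closed)
    interpret N: normal N G using N p_normal_def by blast
    interpret Q: group "G Mod N" by (rule N.factorgroup_is_group)
    obtain c where c: "\<And>y. y \<in> carrier G \<Longrightarrow> y [^] (p ^ c :: nat) \<in> N"
      using p_normal_pow[OF N(1)] by blast
    \<comment> \<open>The surplus \<open>a\<close> in the modulus pays for the cancellation, and \<open>p\<^sup>c\<close> kills exponents modulo \<open>N\<close>.\<close>
    obtain k :: nat where k: "N #> x = N #> (g [^] k)" "int p ^ (a + c) dvd m - int k * n"
      using cong[OF N(1)] by blast
    have "m - int k * n = int p ^ a * (m' - int k * n')"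
      using m' n'(1) unfolding a_def[symmetric] by (simp add: algebra_simps)
    then have "int p ^ c dvd m' - int k * n'"
      using k(2) p0 by (simp add: power_add)
    then obtain t where t: "m' - int k * n' = int p ^ c * t" by blast
    then have kn: "int k * n' = int (p ^ c) * (- t) + m'" by simp
    have "N #> (x [^] n') = N #> ((g [^] int k) [^] n')"
      using N.FactGroup_int_pow[OF x, of n'] N.FactGroup_int_pow[of "g [^] k" n'] k(1) g
      by (simp add: int_pow_int)
    also have "(g [^] int k) [^] n' = (g [^] (p ^ c)) [^] (- t) \<otimes> g [^] m'"
      using g kn by (simp add: int_pow_pow int_pow_mult[symmetric] flip: int_pow_int)
    also have "N #> \<dots> = N #> g [^] m'"
      using c[OF g] g subgroup_int_pow_closed[OF N.is_subgroup] by (intro N.rcoset_mem_mult) auto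
    finally have "inv (g [^] m') \<otimes> x [^] n' \<in> N"
      using N.rcoset_eq_iff x g by simp
    then show False using N(2) by simp
  qed
  have gen: "g [^] i \<in> generate G {g}" for i :: int
    using generate_pow[OF g] by auto
  have "x [^] nat \<bar>n'\<bar> = g [^] (sgn n' * m')"
  proof (cases "n' \<ge> 0")
    case True
    then have "x [^] nat \<bar>n'\<bar> = x [^] n'" by (simp flip: int_pow_int)
    moreover have "n' \<noteq> 0" using n'(2) by auto
    ultimately show ?thesis using eq True by simp
  next
    case False
    then have "x [^] nat \<bar>n'\<bar> = inv (x [^] n')"
      using x by (simp flip: int_pow_int int_pow_neg)
    then show ?thesis using eq False g by (simp add: int_pow_neg)
  qed
  moreover have "\<not> p dvd nat \<bar>n'\<bar>" using n'(2) by (simp add: nat_abs_dvd_iff[symmetric] flip: int_dvd_int_iff)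
  ultimately show ?thesis using gen by metis
qed

lemma cyclically_reduced_separable:
  assumes l: "l \<noteq> []" "set l \<subseteq> (A - H) \<times> (B - H)"
    and iso: "p'_isolated p (generate G {word l}) G"
  shows "p_separable p (generate G {word l}) G"
proof -
  let ?g = "word l" and ?Y = "generate G {word l}"
  have g: "?g \<in> carrier G" by (rule word_closed) (use l in auto)
  have "\<exists>N. p_normal p N G \<and> (\<forall>f \<in> ?Y. inv f \<otimes> x \<notin> N)" if x: "x \<in> carrier G - ?Y" for x
  proof (rule ccontr)
    assume contra: "\<nexists>N. p_normal p N G \<and> (\<forall>f \<in> ?Y. inv f \<otimes> x \<notin> N)"
    \<comment> \<open>Modulo \<open>N\<close> the exponent is periodic, so it can be taken to be a natural number.\<close>
    have "\<exists>k::nat. N #> x = N #> (?g [^] k)" if N: "p_normal p N G" for N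
    proof -
      interpret N: normal N G using N p_normal_def by blast
      obtain f where f: "f \<in> ?Y" "inv f \<otimes> x \<in> N" using contra N by blast
      then obtain i :: int where i: "inv (?g [^] i) \<otimes> x \<in> N"
        using generate_pow[OF g] by auto
      obtain c where c: "\<And>y. y \<in> carrier G \<Longrightarrow> y [^] (p ^ c :: nat) \<in> N"
        using p_normal_pow[OF N] by blast
      let ?P = "int (p ^ c)"
      have "?P > 0" using p prime_gt_0_nat by simp
      then have k: "i = ?P * (i div ?P) + int (nat (i mod ?P))" by simp
      have "N #> x = N #> (?g [^] i)" using i x g by (simp add: N.rcoset_eq_iff)
      also have "?g [^] i = ((?g [^] (p ^ c)) [^] (i div ?P)) \<otimes> ?g [^] nat (i mod ?P)"
        by (subst k) (use g in \<open>simp add: int_pow_mult int_pow_pow del: of_nat_power flip: int_pow_int\<close>)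
      also have "N #> \<dots> = N #> (?g [^] nat (i mod ?P))"
        using c[OF g] g subgroup_int_pow_closed[OF N.is_subgroup] by (intro N.rcoset_mem_mult) auto
      finally show ?thesis by blast
    qed
    then obtain n m :: int where nm: "n \<noteq> 0" "\<forall>e N. p_normal p N G \<longrightarrow>
        (\<exists>k::nat. N #> x = N #> (?g [^] k) \<and> int p ^ e dvd m - int k * n)"
      using exponent_congruence[OF l, of x] x by blast
    obtain n' :: nat where "\<not> p dvd n'" "x [^] n' \<in> ?Y"
      using coprime_power_in_closure[of x ?g n m] x g nm by blast
    then have "x \<in> ?Y" using p'_isolated_coprime[OF iso p, of x n'] x by blast
    then show False using x by blast
  qed
  moreover have "subgroup ?Y G" using g generate_is_subgroup by simp
  ultimately show ?thesis using p_separable_iff[OF p] by blast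
qed

end

section \<open>Separability in the amalgamated product\<close>

lemma p'_isolated_preimage:
  assumes "group A" "group G" "\<iota> \<in> hom A G" "inj_on \<iota> (carrier A)" "subgroup F A"
    and iso: "p'_isolated p (\<iota> ` F) G"
  shows "p'_isolated p F A"
proof -
  interpret group_hom A G \<iota>
    using assms(1-3) by (simp add: group_hom_def group_hom_axioms_def)
  have "c \<in> F" if c: "c \<in> carrier A" "Factorial_Ring.prime q" "q \<noteq> p" "c [^]\<^bsub>A\<^esub> q \<in> F" for c and q :: nat
  proof -
    have "\<iota> (c [^]\<^bsub>A\<^esub> q) \<in> \<iota> ` F" using c(4) by (rule imageI)
    then have "\<iota> c [^]\<^bsub>G\<^esub> q \<in> \<iota> ` F" using c(1) by (simp add: hom_nat_pow)
    then have "\<iota> c \<in> \<iota> ` F"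
      using iso c(2,3) hom_closed[OF c(1)] unfolding p'_isolated_def by blast
    then show ?thesis
      using inj_on_image_mem_iff[OF assms(4) c(1) subgroup.subset[OF assms(5)]] by blast
  qed
  then show ?thesis using assms(5) unfolding p'_isolated_def by blast
qed

lemma (in group) p_separableD:
  assumes "Factorial_Ring.prime p" "p_separable p F G" "x \<in> carrier G" "x \<notin> F"
  obtains N where "p_normal p N G" "\<And>f. f \<in> F \<Longrightarrow> inv f \<otimes> x \<notin> N"
proof -
  have "\<exists>N. p_normal p N G \<and> (\<forall>f \<in> F. inv f \<otimes> x \<notin> N)"
    using assms p_separable_iff[of p F] by auto
  then show thesis using that by auto
qed

text \<open>
  To separate \<open>x\<close> from \<open>\<iota> ` F\<close>: outside the image of \<open>A\<close> it is enough to separate \<open>x\<close> from that image;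
  inside, a subgroup of \<open>A\<close> that separates contains the preimage of one of \<open>G\<close>.
\<close>
lemma p_separable_in_overgroup:
  assumes p: "Factorial_Ring.prime p" and "group A" "group G" "\<iota> \<in> hom A G"
    and F: "p_separable p F A"
    and separated: "\<And>x. x \<in> carrier G \<Longrightarrow> x \<notin> \<iota> ` carrier A \<Longrightarrow>
      \<exists>N. p_normal p N G \<and> (\<forall>a \<in> \<iota> ` carrier A. inv\<^bsub>G\<^esub> a \<otimes>\<^bsub>G\<^esub> x \<notin> N)"
    and induced: "\<And>M. p_normal p M A \<Longrightarrow> \<exists>N. p_normal p N G \<and> {a \<in> carrier A. \<iota> a \<in> N} \<subseteq> M"
  shows "p_separable p (\<iota> ` F) G"
proof -
  interpret group_hom A G \<iota>
    using assms(2-4) by (simp add: group_hom_def group_hom_axioms_def)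
  have subF: "subgroup F A" using F p_separable_def by blast
  then have FA: "F \<subseteq> carrier A" by (rule subgroup.subset)
  have "\<exists>N. p_normal p N G \<and> (\<forall>f \<in> \<iota> ` F. inv\<^bsub>G\<^esub> f \<otimes>\<^bsub>G\<^esub> x \<notin> N)"
    if x: "x \<in> carrier G - \<iota> ` F" for x
  proof (cases "x \<in> \<iota> ` carrier A")
    case False
    then obtain N where "p_normal p N G" "\<forall>a \<in> \<iota> ` carrier A. inv\<^bsub>G\<^esub> a \<otimes>\<^bsub>G\<^esub> x \<notin> N"
      using separated[of x] x by auto
    then show ?thesis using FA by (intro exI[of _ N]) auto
  next
    case True
    then obtain c where c: "c \<in> carrier A" "x = \<iota> c" by blast
    then have "c \<notin> F" using x by blast
    then obtain M where M: "p_normal p M A" "\<And>f. f \<in> F \<Longrightarrow> inv\<^bsub>A\<^esub> f \<otimes>\<^bsub>A\<^esub> c \<notin> M"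
      using G.p_separableD[OF p F c(1)] by metis
    obtain N where N: "p_normal p N G" "{a \<in> carrier A. \<iota> a \<in> N} \<subseteq> M"
      using induced[OF M(1)] by blast
    have "inv\<^bsub>G\<^esub> (\<iota> f) \<otimes>\<^bsub>G\<^esub> x \<notin> N" if f: "f \<in> F" for f
    proof
      have fA: "f \<in> carrier A" using f FA by blast
      assume "inv\<^bsub>G\<^esub> (\<iota> f) \<otimes>\<^bsub>G\<^esub> x \<in> N"
      then have "\<iota> (inv\<^bsub>A\<^esub> f \<otimes>\<^bsub>A\<^esub> c) \<in> N" using fA c by simp
      moreover have "inv\<^bsub>A\<^esub> f \<otimes>\<^bsub>A\<^esub> c \<in> carrier A" using fA c(1) by simp
      ultimately show False using N(2) M(2) f by blast
    qed
    then show ?thesis using N(1) by (intro exI[of _ N]) auto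
  qed
  then show ?thesis
    using subgroup_img_is_subgroup[OF subF] by (simp add: H.p_separable_iff[OF p])
qed

text \<open>
  Separability and isolation are invariant under conjugation, so a cyclic subgroup may be replaced by
  a conjugate with a convenient generator.
\<close>
context group
begin

lemma conj_hom: "y \<in> carrier G \<Longrightarrow> (\<lambda>z. inv y \<otimes> z \<otimes> y) \<in> hom G G"
proof (rule homI)
  fix a b assume "y \<in> carrier G" "a \<in> carrier G" "b \<in> carrier G"
  then have "inv y \<otimes> a \<otimes> y \<otimes> (inv y \<otimes> b \<otimes> y) = inv y \<otimes> a \<otimes> (y \<otimes> inv y) \<otimes> b \<otimes> y"
    by (simp only: m_assoc m_closed inv_closed)
  then show "inv y \<otimes> (a \<otimes> b) \<otimes> y = inv y \<otimes> a \<otimes> y \<otimes> (inv y \<otimes> b \<otimes> y)"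
    using \<open>y \<in> carrier G\<close> \<open>a \<in> carrier G\<close> \<open>b \<in> carrier G\<close> by (simp add: m_assoc)
qed simp

lemma conj_inj: "y \<in> carrier G \<Longrightarrow> inj_on (\<lambda>z. inv y \<otimes> z \<otimes> y) (carrier G)"
  by (rule inj_onI) simp

lemma conj_conj:
  "y \<in> carrier G \<Longrightarrow> z \<in> carrier G \<Longrightarrow> inv (inv y) \<otimes> (inv y \<otimes> z \<otimes> y) \<otimes> inv y = z"
  "y \<in> carrier G \<Longrightarrow> z \<in> carrier G \<Longrightarrow> inv y \<otimes> (inv (inv y) \<otimes> z \<otimes> inv y) \<otimes> y = z"
proof -
  assume yz: "y \<in> carrier G" "z \<in> carrier G"
  have "y \<otimes> (inv y \<otimes> z \<otimes> y) \<otimes> inv y = (y \<otimes> inv y) \<otimes> z \<otimes> (y \<otimes> inv y)"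
    using yz by (simp only: m_assoc m_closed inv_closed)
  then show "inv (inv y) \<otimes> (inv y \<otimes> z \<otimes> y) \<otimes> inv y = z" using yz by simp
  have "inv y \<otimes> (y \<otimes> z \<otimes> inv y) \<otimes> y = (inv y \<otimes> y) \<otimes> z \<otimes> (inv y \<otimes> y)"
    using yz by (simp only: m_assoc m_closed inv_closed)
  then show "inv y \<otimes> (inv (inv y) \<otimes> z \<otimes> inv y) \<otimes> y = z" using yz by simp
qed

lemma conj_image_conj_image:
  assumes "y \<in> carrier G" "Y \<subseteq> carrier G"
  shows "(\<lambda>z. inv (inv y) \<otimes> z \<otimes> inv y) ` (\<lambda>z. inv y \<otimes> z \<otimes> y) ` Y = Y"
proof -
  have "inv (inv y) \<otimes> (inv y \<otimes> z \<otimes> y) \<otimes> inv y = z" if "z \<in> Y" for z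
    using conj_conj(1) assms that by blast
  then have "(\<lambda>z. inv (inv y) \<otimes> (inv y \<otimes> z \<otimes> y) \<otimes> inv y) ` Y = (\<lambda>z. z) ` Y"
    by (rule image_cong[OF HOL.refl])
  then show ?thesis by (simp only: image_image image_ident)
qed

lemma p'_isolated_conj:
  assumes y: "y \<in> carrier G" and Y: "p'_isolated p Y G"
  shows "p'_isolated p ((\<lambda>z. inv y \<otimes> z \<otimes> y) ` Y) G"
proof -
  have sub: "subgroup Y G" using Y p'_isolated_def by blast
  interpret c: group_hom G G "\<lambda>z. inv y \<otimes> z \<otimes> y"
    using conj_hom[OF y] by unfold_locales
  have "(\<lambda>z. inv (inv y) \<otimes> z \<otimes> inv y) ` (\<lambda>z. inv y \<otimes> z \<otimes> y) ` Y = Y"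
    by (rule conj_image_conj_image[OF y subgroup.subset[OF sub]])
  then have "p'_isolated p ((\<lambda>z. inv (inv y) \<otimes> z \<otimes> inv y) ` (\<lambda>z. inv y \<otimes> z \<otimes> y) ` Y) G"
    using Y by (simp only:)
  then show ?thesis
    by (rule p'_isolated_preimage[OF is_group is_group conj_hom[OF inv_closed[OF y]]
          conj_inj[OF inv_closed[OF y]] c.subgroup_img_is_subgroup[OF sub]])
qed

lemma p_separable_conj:
  assumes p: "Factorial_Ring.prime p" and y: "y \<in> carrier G" and Y: "p_separable p Y G"
  shows "p_separable p ((\<lambda>z. inv y \<otimes> z \<otimes> y) ` Y) G"
proof (rule p_separable_in_overgroup[OF p is_group is_group conj_hom[OF y] Y])
  have onto: "x \<in> (\<lambda>z. inv y \<otimes> z \<otimes> y) ` carrier G" if "x \<in> carrier G" for x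
    by (rule image_eqI[where x = "inv (inv y) \<otimes> x \<otimes> inv y"])
      (use conj_conj(2)[OF y that] y that in simp_all)
  show "\<exists>N. p_normal p N G \<and> (\<forall>a \<in> (\<lambda>z. inv y \<otimes> z \<otimes> y) ` carrier G. inv a \<otimes> x \<notin> N)"
    if "x \<in> carrier G" "x \<notin> (\<lambda>z. inv y \<otimes> z \<otimes> y) ` carrier G" for x
    using that onto by blast
  fix M assume M: "p_normal p M G"
  interpret M: normal M G using M p_normal_def by blast
  have "a \<in> M" if "a \<in> carrier G" "inv y \<otimes> a \<otimes> y \<in> M" for a
    using M.inv_op_closed2[OF y that(2)] conj_conj(1)[OF y that(1)] y by simp
  then show "\<exists>N. p_normal p N G \<and> {a \<in> carrier G. inv y \<otimes> a \<otimes> y \<in> N} \<subseteq> M"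
    using M by blast
qed

end

text \<open>
  Separation inside \<open>A\<close> or \<open>B\<close> passes to \<open>G\<close> as soon as every normal subgroup of \<open>p\<close>-power index of
  a factor contains the preimage of one of \<open>G\<close>.
\<close>
lemma (in amalgam_presentation) p_amalgam_P:
  assumes p: "Factorial_Ring.prime p"
    and res: "residually_p_finite p A" "residually_p_finite p B"
    and sep: "p_separable p H A" "p_separable p K B"
    and induced_A: "\<And>M. p_normal p M A \<Longrightarrow> \<exists>N. p_normal p N P \<and> {a \<in> carrier A. \<iota>\<^sub>A a \<in> N} \<subseteq> M"
    and induced_B: "\<And>M. p_normal p M B \<Longrightarrow> \<exists>N. p_normal p N P \<and> {b \<in> carrier B. \<iota>\<^sub>B b \<in> N} \<subseteq> M"
  shows "p_amalgam P p (\<iota>\<^sub>A ` carrier A) (\<iota>\<^sub>B ` carrier B) (\<iota>\<^sub>A ` H)"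
proof -
  interpret P: group P by (rule group_P)
  interpret a: group_hom A P \<iota>\<^sub>A using hom_\<iota>A by unfold_locales
  interpret b: group_hom B P \<iota>\<^sub>B using hom_\<iota>B by unfold_locales
  have HK: "\<iota>\<^sub>A ` H = \<iota>\<^sub>B ` K"
    using \<iota>_\<phi> \<phi>_K by force
  show ?thesis
  proof (intro p_amalgam.intro p_amalgam_axioms.intro group_P p)
    show "subgroup (\<iota>\<^sub>A ` carrier A) P" by (rule a.subgroup_img_is_subgroup[OF A.subgroup_self])
    show "subgroup (\<iota>\<^sub>B ` carrier B) P" by (rule b.subgroup_img_is_subgroup[OF B.subgroup_self])
    show "subgroup (\<iota>\<^sub>A ` H) P" by (rule a.subgroup_img_is_subgroup[OF sub_H])
    show "\<iota>\<^sub>A ` H \<subseteq> \<iota>\<^sub>A ` carrier A" using H_A by blast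
    show "\<iota>\<^sub>A ` H \<subseteq> \<iota>\<^sub>B ` carrier B" unfolding HK using K_B by blast
    show "carrier P = generate P (\<iota>\<^sub>A ` carrier A \<union> \<iota>\<^sub>B ` carrier B)" by (rule P_generated)
  next
    fix f g
    assume f: "f \<in> hom (P\<lparr>carrier := \<iota>\<^sub>A ` carrier A\<rparr>) (Ops TYPE(('a + 'b) list set))"
      and g: "g \<in> hom (P\<lparr>carrier := \<iota>\<^sub>B ` carrier B\<rparr>) (Ops TYPE(('a + 'b) list set))"
      and fg: "\<And>h. h \<in> \<iota>\<^sub>A ` H \<Longrightarrow> f h = g h"
    have "f \<circ> \<iota>\<^sub>A \<in> hom A (Ops TYPE(('a + 'b) list set))"
      by (rule homI) (use hom_in_carrier[OF f] hom_mult[OF f] in simp_all)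
    moreover have "g \<circ> \<iota>\<^sub>B \<in> hom B (Ops TYPE(('a + 'b) list set))"
      by (rule homI) (use hom_in_carrier[OF g] hom_mult[OF g] in simp_all)
    moreover have "(f \<circ> \<iota>\<^sub>A) h = (g \<circ> \<iota>\<^sub>B) (\<phi> h)" if "h \<in> H" for h
      using fg that \<iota>_\<phi>[OF that] by (metis comp_apply image_eqI)
    ultimately obtain \<theta> where "\<theta> \<in> hom P (Ops TYPE(('a + 'b) list set))"
      "\<forall>a \<in> carrier A. \<theta> (\<iota>\<^sub>A a) = (f \<circ> \<iota>\<^sub>A) a" "\<forall>b \<in> carrier B. \<theta> (\<iota>\<^sub>B b) = (g \<circ> \<iota>\<^sub>B) b"
      using P_universal[OF group_Perms] by metis
    then show "\<exists>\<theta> \<in> hom P (Ops TYPE(('a + 'b) list set)).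
        (\<forall>a \<in> \<iota>\<^sub>A ` carrier A. \<theta> a = f a) \<and> (\<forall>b \<in> \<iota>\<^sub>B ` carrier B. \<theta> b = g b)"
      by (intro bexI[of _ \<theta>]) auto
  next
    fix x assume "x \<in> \<iota>\<^sub>A ` carrier A - \<iota>\<^sub>A ` H"
    then obtain c where c: "c \<in> carrier A" "c \<notin> H" "x = \<iota>\<^sub>A c" by blast
    obtain M where M: "p_normal p M A" "\<And>h. h \<in> H \<Longrightarrow> inv\<^bsub>A\<^esub> h \<otimes>\<^bsub>A\<^esub> c \<notin> M"
      using A.p_separableD[OF p sep(1) c(1,2)] by metis
    obtain N where N: "p_normal p N P" "{a \<in> carrier A. \<iota>\<^sub>A a \<in> N} \<subseteq> M"
      using induced_A[OF M(1)] by blast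
    have "inv\<^bsub>P\<^esub> \<iota>\<^sub>A h \<otimes>\<^bsub>P\<^esub> x \<notin> N" if h: "h \<in> H" for h
    proof -
      have "inv\<^bsub>A\<^esub> h \<otimes>\<^bsub>A\<^esub> c \<in> carrier A" using h c H_A by simp
      then have "\<iota>\<^sub>A (inv\<^bsub>A\<^esub> h \<otimes>\<^bsub>A\<^esub> c) \<notin> N" using h M(2) N(2) by blast
      then show ?thesis using h c H_A by simp
    qed
    then show "\<exists>N. p_normal p N P \<and> (\<forall>h \<in> \<iota>\<^sub>A ` H. inv\<^bsub>P\<^esub> h \<otimes>\<^bsub>P\<^esub> x \<notin> N)"
      using N(1) by blast
  next
    fix x assume "x \<in> \<iota>\<^sub>B ` carrier B - \<iota>\<^sub>A ` H"
    then obtain c where c: "c \<in> carrier B" "c \<notin> K" "x = \<iota>\<^sub>B c" unfolding HK by blast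
    obtain M where M: "p_normal p M B" "\<And>h. h \<in> K \<Longrightarrow> inv\<^bsub>B\<^esub> h \<otimes>\<^bsub>B\<^esub> c \<notin> M"
      using B.p_separableD[OF p sep(2) c(1,2)] by metis
    obtain N where N: "p_normal p N P" "{b \<in> carrier B. \<iota>\<^sub>B b \<in> N} \<subseteq> M"
      using induced_B[OF M(1)] by blast
    have "inv\<^bsub>P\<^esub> \<iota>\<^sub>B h \<otimes>\<^bsub>P\<^esub> x \<notin> N" if h: "h \<in> K" for h
    proof -
      have "inv\<^bsub>B\<^esub> h \<otimes>\<^bsub>B\<^esub> c \<in> carrier B" using h c K_B by simp
      then have "\<iota>\<^sub>B (inv\<^bsub>B\<^esub> h \<otimes>\<^bsub>B\<^esub> c) \<notin> N" using h M(2) N(2) by blast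
      then show ?thesis using h c K_B by simp
    qed
    then show "\<exists>N. p_normal p N P \<and> (\<forall>h \<in> \<iota>\<^sub>A ` H. inv\<^bsub>P\<^esub> h \<otimes>\<^bsub>P\<^esub> x \<notin> N)"
      unfolding HK using N(1) by blast
  next
    fix x assume x: "x \<in> \<iota>\<^sub>A ` carrier A" "x \<noteq> \<one>\<^bsub>P\<^esub>"
    then obtain c where c: "c \<in> carrier A" "x = \<iota>\<^sub>A c" by blast
    then have c1: "c \<notin> {\<one>\<^bsub>A\<^esub>}" using x(2) by auto
    obtain M where M: "p_normal p M A" "inv\<^bsub>A\<^esub> \<one>\<^bsub>A\<^esub> \<otimes>\<^bsub>A\<^esub> c \<notin> M"
      using A.p_separableD[OF p res(1)[unfolded residually_p_finite_def] c(1) c1] by blast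
    obtain N where N: "p_normal p N P" "{z \<in> carrier A. \<iota>\<^sub>A z \<in> N} \<subseteq> M"
      using induced_A[OF M(1)] by blast
    have "c \<notin> M" using M(2) c(1) by simp
    then show "\<exists>N. p_normal p N P \<and> x \<notin> N"
      using N c by (intro exI[of _ N]) blast
  next
    fix x assume x: "x \<in> \<iota>\<^sub>B ` carrier B" "x \<noteq> \<one>\<^bsub>P\<^esub>"
    then obtain c where c: "c \<in> carrier B" "x = \<iota>\<^sub>B c" by blast
    then have c1: "c \<notin> {\<one>\<^bsub>B\<^esub>}" using x(2) by auto
    obtain M where M: "p_normal p M B" "inv\<^bsub>B\<^esub> \<one>\<^bsub>B\<^esub> \<otimes>\<^bsub>B\<^esub> c \<notin> M"
      using B.p_separableD[OF p res(2)[unfolded residually_p_finite_def] c(1) c1] by blast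
    obtain N where N: "p_normal p N P" "{z \<in> carrier B. \<iota>\<^sub>B z \<in> N} \<subseteq> M"
      using induced_B[OF M(1)] by blast
    have "c \<notin> M" using M(2) c(1) by simp
    then show "\<exists>N. p_normal p N P \<and> x \<notin> N"
      using N c by (intro exI[of _ N]) blast
  qed
qed

text \<open>
  An element of the kernel would lie in every normal subgroup of \<open>p\<close>-power index of \<open>A\<close>.
\<close>
lemma inj_on_of_induced:
  assumes p: "Factorial_Ring.prime p" and "group A" "group G" "\<iota> \<in> hom A G"
    and res: "residually_p_finite p A"
    and induced: "\<And>M. p_normal p M A \<Longrightarrow> \<exists>N. p_normal p N G \<and> {a \<in> carrier A. \<iota> a \<in> N} \<subseteq> M"
  shows "inj_on \<iota> (carrier A)"
proof -
  interpret group_hom A G \<iota>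
    using assms(2-4) by (simp add: group_hom_def group_hom_axioms_def)
  have "c = \<one>\<^bsub>A\<^esub>" if c: "c \<in> carrier A" "\<iota> c = \<one>\<^bsub>G\<^esub>" for c
  proof (rule ccontr)
    assume "c \<noteq> \<one>\<^bsub>A\<^esub>"
    then have c1: "c \<notin> {\<one>\<^bsub>A\<^esub>}" by simp
    obtain M where M: "p_normal p M A" "inv\<^bsub>A\<^esub> \<one>\<^bsub>A\<^esub> \<otimes>\<^bsub>A\<^esub> c \<notin> M"
      using G.p_separableD[OF p res[unfolded residually_p_finite_def] c(1) c1] by blast
    obtain N where N: "p_normal p N G" "{a \<in> carrier A. \<iota> a \<in> N} \<subseteq> M"
      using induced[OF M(1)] by blast
    have "subgroup N G" using N(1) unfolding p_normal_def finite_p_index_def by blast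
    then have "\<one>\<^bsub>G\<^esub> \<in> N" by (rule subgroup.one_closed)
    then show False using M(2) N(2) c by auto
  qed
  then show ?thesis by (simp add: inj_on_one_iff)
qed

text \<open>
  A cyclic subgroup inside a factor is also \<open>p'\<close>-isolated in that factor; as it is not in \<open>\<Delta>\<close>, it
  is separable there, and this carries over to \<open>G\<close>.
\<close>
lemma cyclic_in_factor_separable:
  assumes p: "Factorial_Ring.prime p" and groups: "group A" "group G" and hom: "\<iota> \<in> hom A G"
    and res: "residually_p_finite p A"
    and separated: "\<And>x. x \<in> carrier G \<Longrightarrow> x \<notin> \<iota> ` carrier A \<Longrightarrow>
      \<exists>N. p_normal p N G \<and> (\<forall>a \<in> \<iota> ` carrier A. inv\<^bsub>G\<^esub> a \<otimes>\<^bsub>G\<^esub> x \<notin> N)"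
    and induced: "\<And>M. p_normal p M A \<Longrightarrow> \<exists>N. p_normal p N G \<and> {a \<in> carrier A. \<iota> a \<in> N} \<subseteq> M"
    and c: "c \<in> \<iota> ` carrier A" and iso: "p'_isolated p (generate G {c}) G"
    and not_\<Delta>: "\<And>F. F \<in> Delta p A \<Longrightarrow> generate G {c} \<noteq> \<iota> ` F"
  shows "p_separable p (generate G {c}) G"
proof -
  interpret group_hom A G \<iota>
    using groups hom by (simp add: group_hom_def group_hom_axioms_def)
  obtain a where a: "a \<in> carrier A" "c = \<iota> a" using c by blast
  let ?F = "generate A {a}"
  have F: "generate G {c} = \<iota> ` ?F" using generate_img[of "{a}"] a by simp
  have subF: "subgroup ?F A" using a by (simp add: G.generate_is_subgroup)
  have "inj_on \<iota> (carrier A)"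
    by (rule inj_on_of_induced[OF p groups hom res]) (rule induced)
  then have "p'_isolated p ?F A"
    by (rule p'_isolated_preimage[OF groups hom _ subF]) (use iso F in simp)
  then have sep: "p_separable p ?F A"
    using not_\<Delta>[of ?F] F a(1) unfolding Delta_def cyclic_subgroup_def by blast
  show ?thesis
    unfolding F
  proof (rule p_separable_in_overgroup[OF p groups hom sep])
    show "\<exists>N. p_normal p N G \<and> (\<forall>a \<in> \<iota> ` carrier A. inv\<^bsub>G\<^esub> a \<otimes>\<^bsub>G\<^esub> x \<notin> N)"
      if "x \<in> carrier G" "x \<notin> \<iota> ` carrier A" for x
      by (rule separated[OF that])
    show "\<exists>N. p_normal p N G \<and> {a \<in> carrier A. \<iota> a \<in> N} \<subseteq> M" if "p_normal p M A" for M
      by (rule induced[OF that])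
  qed
qed

theorem theorem1p7:
  fixes p :: nat
    and A :: "('a, 'c) monoid_scheme"
    and B :: "('b, 'd) monoid_scheme"
    and H :: "'a set" and K :: "'b set" and \<phi> :: "'a \<Rightarrow> 'b"
    and G :: "('a + 'b) list set monoid"
  assumes "Factorial_Ring.prime p"
    and "group A" and "group B"
    and "subgroup H A" and "subgroup K B"
    and "\<phi> \<in> iso (A\<lparr>carrier := H\<rparr>) (B\<lparr>carrier := K\<rparr>)"
    and "G = amalgamated_product A B H \<phi>"
    and "residually_p_finite p A" and "residually_p_finite p B"
    and "p_separable p H A" and "p_separable p K B"
    and "\<And>M N. M \<lhd> A \<Longrightarrow> finite_p_index p M A \<Longrightarrow> N \<lhd> B \<Longrightarrow> finite_p_index p N B \<Longrightarrow>
           \<exists>(R, S) \<in> Omega p A B H \<phi>. R \<subseteq> M \<and> S \<subseteq> N"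
  shows "\<forall>Y. cyclic_subgroup Y G \<and> p'_isolated p Y G \<and>
           \<not> (\<exists>F \<in> (`) (amalg_inl A B H \<phi>) ` Delta p A \<union> (`) (amalg_inr A B H \<phi>) ` Delta p B.
                conjugate_subgroups G F Y)
           \<longrightarrow> p_separable p Y G"
proof (intro allI impI)
  note p = assms(1) and G_def = assms(7) and res = assms(8,9)
  interpret amalgam_presentation A B H K \<phi>
    by (intro amalgam_presentation.intro amalgam_presentation_axioms.intro assms(2-6))
  have homs: "\<iota>\<^sub>A \<in> hom A G" "\<iota>\<^sub>B \<in> hom B G"
    unfolding G_def by (rule hom_\<iota>A, rule hom_\<iota>B)
  have induced: "\<exists>N. p_normal p N G \<and> {a \<in> carrier A. \<iota>\<^sub>A a \<in> N} \<subseteq> M \<and> {b \<in> carrier B. \<iota>\<^sub>B b \<in> N} \<subseteq> M'"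
    if M: "p_normal p M A" "p_normal p M' B" for M M'
  proof -
    obtain R S where RS: "(R, S) \<in> Omega p A B H \<phi>" "R \<subseteq> M" "S \<subseteq> M'"
      using assms(12)[of M M'] M unfolding p_normal_def by auto
    then show ?thesis unfolding Omega_def G_def p_normal_def by blast
  qed
  have induced_A: "\<exists>N. p_normal p N G \<and> {a \<in> carrier A. \<iota>\<^sub>A a \<in> N} \<subseteq> M" if "p_normal p M A" for M
    using induced[OF that B.p_normal_carrier[OF p]] by blast
  have induced_B: "\<exists>N. p_normal p N G \<and> {b \<in> carrier B. \<iota>\<^sub>B b \<in> N} \<subseteq> M" if "p_normal p M B" for M
    using induced[OF A.p_normal_carrier[OF p] that] by blast
  interpret G: p_amalgam G p "\<iota>\<^sub>A ` carrier A" "\<iota>\<^sub>B ` carrier B" "\<iota>\<^sub>A ` H"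
    unfolding G_def
    by (rule p_amalgam_P[OF p assms(8-11)]) (use induced_A induced_B in \<open>simp_all only: G_def\<close>)
  fix Y
  assume Y: "cyclic_subgroup Y G \<and> p'_isolated p Y G \<and>
           \<not> (\<exists>F \<in> (`) \<iota>\<^sub>A ` Delta p A \<union> (`) \<iota>\<^sub>B ` Delta p B. conjugate_subgroups G F Y)"
  then obtain g where g: "g \<in> carrier G" "Y = generate G {g}"
    unfolding cyclic_subgroup_def by blast
  obtain y where y: "y \<in> carrier G"
    and form: "inv\<^bsub>G\<^esub> y \<otimes>\<^bsub>G\<^esub> g \<otimes>\<^bsub>G\<^esub> y \<in> \<iota>\<^sub>A ` carrier A \<or>
      inv\<^bsub>G\<^esub> y \<otimes>\<^bsub>G\<^esub> g \<otimes>\<^bsub>G\<^esub> y \<in> \<iota>\<^sub>B ` carrier B \<or>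
      (\<exists>l. l \<noteq> [] \<and> set l \<subseteq> (\<iota>\<^sub>A ` carrier A - \<iota>\<^sub>A ` H) \<times> (\<iota>\<^sub>B ` carrier B - \<iota>\<^sub>A ` H) \<and>
        inv\<^bsub>G\<^esub> y \<otimes>\<^bsub>G\<^esub> g \<otimes>\<^bsub>G\<^esub> y = G.word l)"
    by (rule bexE[OF G.conjugate_form[OF g(1)]]) (rule that)
  let ?conj = "\<lambda>y z. inv\<^bsub>G\<^esub> y \<otimes>\<^bsub>G\<^esub> z \<otimes>\<^bsub>G\<^esub> y"
  let ?c = "?conj y g"
  interpret conj: group_hom G G "?conj y"
    using G.conj_hom[OF y] by unfold_locales
  have YG: "Y \<subseteq> carrier G" using g G.generate_incl by blast
  have cY: "?conj y ` Y = generate G {?c}"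
    using conj.generate_img[of "{g}"] g by simp
  have Y_conj: "?conj (inv\<^bsub>G\<^esub> y) ` generate G {?c} = Y"
    using G.conj_image_conj_image[OF y YG] cY by simp
  have iso: "p'_isolated p (generate G {?c}) G"
    using G.p'_isolated_conj[OF y, of p Y] Y cY by simp
  have not_\<Delta>: "generate G {?c} \<noteq> F"
    if "F \<in> (`) \<iota>\<^sub>A ` Delta p A \<union> (`) \<iota>\<^sub>B ` Delta p B" for F
  proof
    assume "generate G {?c} = F"
    then have "conjugate_subgroups G F Y"
      using Y_conj y unfolding conjugate_subgroups_def by (metis G.inv_closed)
    then show False using Y that by blast
  qed
  have "p_separable p (generate G {?c}) G"
    using form
  proof (elim disjE exE conjE)
    assume c: "?c \<in> \<iota>\<^sub>A ` carrier A"
    show ?thesis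
    proof (rule cyclic_in_factor_separable[OF p assms(2) G.is_group homs(1) res(1) _ _ c iso])
      show "\<exists>N. p_normal p N G \<and> (\<forall>a \<in> \<iota>\<^sub>A ` carrier A. inv\<^bsub>G\<^esub> a \<otimes>\<^bsub>G\<^esub> x \<notin> N)"
        if "x \<in> carrier G" "x \<notin> \<iota>\<^sub>A ` carrier A" for x
        by (rule G.A_separated[OF that])
      show "\<exists>N. p_normal p N G \<and> {a \<in> carrier A. \<iota>\<^sub>A a \<in> N} \<subseteq> M" if "p_normal p M A" for M
        by (rule induced_A[OF that])
      show "generate G {?c} \<noteq> \<iota>\<^sub>A ` F" if "F \<in> Delta p A" for F
        by (rule not_\<Delta>) (use that in blast)
    qed
  next
    assume c: "?c \<in> \<iota>\<^sub>B ` carrier B"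
    show ?thesis
    proof (rule cyclic_in_factor_separable[OF p assms(3) G.is_group homs(2) res(2) _ _ c iso])
      show "\<exists>N. p_normal p N G \<and> (\<forall>b \<in> \<iota>\<^sub>B ` carrier B. inv\<^bsub>G\<^esub> b \<otimes>\<^bsub>G\<^esub> x \<notin> N)"
        if "x \<in> carrier G" "x \<notin> \<iota>\<^sub>B ` carrier B" for x
        by (rule p_amalgam.A_separated[OF G.swapped that])
      show "\<exists>N. p_normal p N G \<and> {b \<in> carrier B. \<iota>\<^sub>B b \<in> N} \<subseteq> M" if "p_normal p M B" for M
        by (rule induced_B[OF that])
      show "generate G {?c} \<noteq> \<iota>\<^sub>B ` F" if "F \<in> Delta p B" for F
        by (rule not_\<Delta>) (use that in blast)
    qed
  next
    fix l
    assume "l \<noteq> []" "set l \<subseteq> (\<iota>\<^sub>A ` carrier A - \<iota>\<^sub>A ` H) \<times> (\<iota>\<^sub>B ` carrier B - \<iota>\<^sub>A ` H)"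
      "?c = G.word l"
    then show ?thesis
      using G.cyclically_reduced_separable[of l] iso by simp
  qed
  then show "p_separable p Y G"
    using G.p_separable_conj[OF p, of "inv\<^bsub>G\<^esub> y" "generate G {?c}"] Y_conj y by simp
qed

end
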